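(* Let $k$ be an algebraically closed field of characteristic $0$, let $t\neq 0$ be an integer, and let $H=F(t)$. Then $H$ is a coradically graded Hopf algebra with respect to the $y$-grading $H=\bigoplus_{n\ge 0}H(n)$; that is, $H_0=H(0)$ and $H_1=H(0)\oplus H(1)$, where $\{H_n\}_{n\ge0}$ is the coradical filtration of $H$.
   Context: For an integer $t$, $F(t)$ is the algebra $k\langle x^{\pm1},y\rangle$ with relations $xx^{-1}=x^{-1}x=1$ only, with Hopf structure $\Delta(x)=x\otimes x$, $\Delta(y)=y\otimes 1+x^t\otimes y$, $S(x)=x^{-1}$, $S(y)=-x^{-t}y$, $\epsilon(x)=1$, $\epsilon(y)=0$. The $y$-grading on $F(t)$ is the algebra grading with $\deg_y y=1$, $\deg_y x^{\pm1}=0$; $H(n)$ is the $k$-span of the homogeneous elements of $y$-degree $n$, i.e. of the monomials $x^{i_1}yx^{i_2}y\cdots yx^{i_{n+1}}$ with $n$ occurrences of $y$. A graded coalgebra is a coalgebra $C=\bigoplus_{i\ge0}C(i)$ with $\Delta(C(n))\subset\bigoplus_{i=0}^nC(i)\otimes C(n-i)$ for all $n\ge 0$ and $\epsilon(C(n))=0$ for $n\ge1$. It is coradically graded if $C_0=C(0)$ and $C_1=C(0)\oplus C(1)$. A graded Hopf algebra is coradically graded if it is so as a graded coalgebra. The coradical $C_0$ is the sum of the simple subcoalgebras, and $C_n=\Delta^{-1}(C\otimes C_{n-1}+C_0\otimes C)$. *)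

theory Defs
  imports
    "HOL-Library.Poly_Mapping"
    "HOL-Library.Product_Plus"
    "HOL-Computational_Algebra.Polynomial"
begin

section \<open>Vector spaces with a basis and their tensor products\<close>

text \<open>
  The vector space over \<open>'k\<close> with basis \<open>'b\<close> is the type \<open>'b \<Rightarrow>\<^sub>0 'k\<close> of finitely supported functions.
  The tensor product of the spaces with bases \<open>'b\<close> and \<open>'c\<close> is the space with basis \<open>'b \<times> 'c\<close>; the
  lemma \<open>tensor_universal\<close> below is its universal property.  If \<open>'b\<close> is a monoid (written
  additively, as \<^theory>\<open>HOL-Library.Poly_Mapping\<close> demands), then multiplication on
  \<open>'b \<Rightarrow>\<^sub>0 'k\<close> is that of the monoid algebra, and multiplication on \<open>'b \<times> 'b \<Rightarrow>\<^sub>0 'k\<close> is the usual one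
  of a tensor product of algebras (lemma \<open>tensor_times\<close>).
\<close>

definition smul :: "'k::field \<Rightarrow> ('b \<Rightarrow>\<^sub>0 'k) \<Rightarrow> ('b \<Rightarrow>\<^sub>0 'k)" where
  "smul c p = Poly_Mapping.map ((*) c) p"

abbreviation pm_subspace :: "('b \<Rightarrow>\<^sub>0 'k::field) set \<Rightarrow> bool" where
  "pm_subspace \<equiv> module.subspace smul"

abbreviation pm_span :: "('b \<Rightarrow>\<^sub>0 'k::field) set \<Rightarrow> ('b \<Rightarrow>\<^sub>0 'k) set" where
  "pm_span \<equiv> module.span smul"

abbreviation basis :: "'b \<Rightarrow> ('b \<Rightarrow>\<^sub>0 'k::field)" where
  "basis b \<equiv> Poly_Mapping.single b 1"

definition lin_ext :: "('k::field \<Rightarrow> 'v::ab_group_add \<Rightarrow> 'v) \<Rightarrow> ('b \<Rightarrow> 'v) \<Rightarrow> ('b \<Rightarrow>\<^sub>0 'k) \<Rightarrow> 'v" where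
  "lin_ext s f p = (\<Sum>b\<in>Poly_Mapping.keys p. s (Poly_Mapping.lookup p b) (f b))"

definition tensor :: "('b \<Rightarrow>\<^sub>0 'k::field) \<Rightarrow> ('c \<Rightarrow>\<^sub>0 'k) \<Rightarrow> ('b \<times> 'c \<Rightarrow>\<^sub>0 'k)" (infixr \<open>\<otimes>\<close> 75) where
  "p \<otimes> q = Abs_poly_mapping (\<lambda>(b, c). Poly_Mapping.lookup p b * Poly_Mapping.lookup q c)"

definition tensor_lift ::
  "('k::field \<Rightarrow> 'v::ab_group_add \<Rightarrow> 'v) \<Rightarrow> (('b \<Rightarrow>\<^sub>0 'k) \<Rightarrow> ('c \<Rightarrow>\<^sub>0 'k) \<Rightarrow> 'v) \<Rightarrow> ('b \<times> 'c \<Rightarrow>\<^sub>0 'k) \<Rightarrow> 'v"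
  where "tensor_lift s B = lin_ext s (\<lambda>(b, c). B (basis b) (basis c))"

definition tensor_space ::
  "('b \<Rightarrow>\<^sub>0 'k::field) set \<Rightarrow> ('c \<Rightarrow>\<^sub>0 'k) set \<Rightarrow> ('b \<times> 'c \<Rightarrow>\<^sub>0 'k) set" where
  "tensor_space A B = pm_span {a \<otimes> b | a b. a \<in> A \<and> b \<in> B}"

definition subspace_sum :: "('b \<Rightarrow>\<^sub>0 'k::field) set \<Rightarrow> ('b \<Rightarrow>\<^sub>0 'k) set \<Rightarrow> ('b \<Rightarrow>\<^sub>0 'k) set" where
  "subspace_sum A B = {a + b | a b. a \<in> A \<and> b \<in> B}"

definition direct_sum_decomposition :: "(nat \<Rightarrow> ('b \<Rightarrow>\<^sub>0 'k::field) set) \<Rightarrow> bool" where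
  "direct_sum_decomposition C \<longleftrightarrow>
     (\<forall>n. pm_subspace (C n)) \<and>
     (\<forall>c. \<exists>!f :: nat \<Rightarrow>\<^sub>0 ('b \<Rightarrow>\<^sub>0 'k).
        (\<forall>n. Poly_Mapping.lookup f n \<in> C n) \<and>
        c = (\<Sum>n\<in>Poly_Mapping.keys f. Poly_Mapping.lookup f n))"

locale algebra_over = vector_space s for s :: "'k::field \<Rightarrow> 'a::ring_1 \<Rightarrow> 'a" +
  assumes scale_mult_left: "s c a * b = s c (a * b)"
    and scale_mult_right: "a * s c b = s c (a * b)"

definition algebra_hom ::
  "('k::field \<Rightarrow> 'a::ring_1 \<Rightarrow> 'a) \<Rightarrow> ('k \<Rightarrow> 'b::ring_1 \<Rightarrow> 'b) \<Rightarrow> ('a \<Rightarrow> 'b) \<Rightarrow> bool" where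
  "algebra_hom s s' f \<longleftrightarrow>
     Vector_Spaces.linear s s' f \<and> f 1 = 1 \<and> (\<forall>a b. f (a * b) = f a * f b)"

subsection \<open>Basic facts\<close>

lemma lookup_smul [simp]: "Poly_Mapping.lookup (smul c p) b = c * Poly_Mapping.lookup p b"
  by (simp add: smul_def Poly_Mapping.map.rep_eq when_def)

lemma vector_space_smul: "vector_space smul"
  by unfold_locales (auto intro!: poly_mapping_eqI simp: lookup_add algebra_simps)

interpretation pm: vector_space smul
  by (rule vector_space_smul)

lemma smul_single [simp]: "smul c (Poly_Mapping.single b d) = Poly_Mapping.single b (c * d)"
  by (auto intro!: poly_mapping_eqI simp: lookup_single when_def)

lemma smul_one_eq: "smul c (1 :: 'b::monoid_add \<Rightarrow>\<^sub>0 'k::field) = Poly_Mapping.single 0 c"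
  by (simp flip: single_one)

lemma smul_conv_mult: "smul c p = Poly_Mapping.single 0 c * p"
  for p :: "'b::monoid_add \<Rightarrow>\<^sub>0 'k::field"
  by (simp add: smul_def mult_map_scale_conv_mult)

lemma poly_mapping_expand: "p = (\<Sum>b\<in>Poly_Mapping.keys p. smul (Poly_Mapping.lookup p b) (basis b))"
  by (rule poly_mapping_eqI)
    (auto simp: lookup_sum lookup_single when_def in_keys_iff if_distrib [of "\<lambda>x. _ * x"] cong: if_cong)

lemma pm_linear_eqI:
  assumes f: "Vector_Spaces.linear smul s f" and g: "Vector_Spaces.linear smul s g"
    and eq: "\<And>b. f (basis b) = g (basis b)"
  shows "f p = g p"
proof -
  interpret f: Vector_Spaces.linear smul s f by (fact f)
  interpret g: Vector_Spaces.linear smul s g by (fact g)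
  have "f (\<Sum>b\<in>Poly_Mapping.keys p. smul (Poly_Mapping.lookup p b) (basis b))
      = g (\<Sum>b\<in>Poly_Mapping.keys p. smul (Poly_Mapping.lookup p b) (basis b))"
    unfolding f.sum g.sum f.scale g.scale eq ..
  then show ?thesis
    by (simp only: poly_mapping_expand [symmetric])
qed

lemma lin_ext_superset:
  assumes "vector_space s" "finite A" "Poly_Mapping.keys p \<subseteq> A"
  shows "lin_ext s f p = (\<Sum>b\<in>A. s (Poly_Mapping.lookup p b) (f b))"
proof -
  interpret vector_space s by fact
  show ?thesis
    unfolding lin_ext_def
    by (rule sum.mono_neutral_left) (use assms in \<open>auto simp: in_keys_iff\<close>)
qed

lemma linear_lin_ext:
  assumes "vector_space s"
  shows "Vector_Spaces.linear smul s (lin_ext s f)"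
proof -
  interpret vector_space s by fact
  show ?thesis
    unfolding Vector_Spaces.linear_iff
  proof (intro conjI allI)
    fix p q :: "'c \<Rightarrow>\<^sub>0 'a"
    let ?A = "Poly_Mapping.keys p \<union> Poly_Mapping.keys q"
    have "Poly_Mapping.keys (p + q) \<subseteq> ?A"
      by (rule Poly_Mapping.keys_add)
    then show "lin_ext s f (p + q) = lin_ext s f p + lin_ext s f q"
      by (simp add: lin_ext_superset [OF assms, of ?A] lookup_add scale_left_distrib sum.distrib)
  next
    fix c and p :: "'c \<Rightarrow>\<^sub>0 'a"
    have "Poly_Mapping.keys (smul c p) \<subseteq> Poly_Mapping.keys p"
      by (auto simp: in_keys_iff)
    then show "lin_ext s f (smul c p) = s c (lin_ext s f p)"
      by (simp add: lin_ext_superset [OF assms, of "Poly_Mapping.keys p"] scale_sum_right)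
  qed (fact vector_space_smul assms)+
qed

lemma lin_ext_basis:
  assumes "vector_space s"
  shows "lin_ext s f (basis b) = f b"
proof -
  interpret vector_space s by fact
  show ?thesis by (simp add: lin_ext_def)
qed

lemma lookup_tensor [simp]:
  "Poly_Mapping.lookup (p \<otimes> q) x = Poly_Mapping.lookup p (fst x) * Poly_Mapping.lookup q (snd x)"
proof -
  have "finite {x. (case x of (b, c) \<Rightarrow> Poly_Mapping.lookup p b * Poly_Mapping.lookup q c) \<noteq> 0}"
    by (rule finite_subset [of _ "Poly_Mapping.keys p \<times> Poly_Mapping.keys q"])
      (auto simp: in_keys_iff)
  then show ?thesis
    by (simp add: tensor_def case_prod_unfold)
qed

lemma tensor_basis [simp]: "basis b \<otimes> basis c = basis (b, c)"
  by (rule poly_mapping_eqI) (auto simp: lookup_single when_def)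

lemma tensor_add_left: "(p + q) \<otimes> r = p \<otimes> r + q \<otimes> r"
  and tensor_add_right: "r \<otimes> (p + q) = r \<otimes> p + r \<otimes> q"
  and tensor_smul_left: "smul c p \<otimes> r = smul c (p \<otimes> r)"
  and tensor_smul_right: "p \<otimes> smul c r = smul c (p \<otimes> r)"
  by (auto intro!: poly_mapping_eqI simp: lookup_add algebra_simps)

lemma linear_tensor_left: "Vector_Spaces.linear smul smul (\<lambda>p. p \<otimes> q)"
  and linear_tensor_right: "Vector_Spaces.linear smul smul (\<lambda>q. p \<otimes> q)"
  unfolding Vector_Spaces.linear_iff
  by (simp_all add: vector_space_smul tensor_add_left tensor_add_right tensor_smul_left
      tensor_smul_right)

lemma linear_tensor_lift:
  assumes "vector_space s"
  shows "Vector_Spaces.linear smul s (tensor_lift s B)"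
  unfolding tensor_lift_def by (rule linear_lin_ext [OF assms])

lemma tensor_lift_tensor:
  assumes s: "vector_space s"
    and l: "\<And>q. Vector_Spaces.linear smul s (\<lambda>p. B p q)"
    and r: "\<And>p. Vector_Spaces.linear smul s (B p)"
  shows "tensor_lift s B (p \<otimes> q) = B p q"
proof -
  note comp = Vector_Spaces.linear_compose [unfolded o_def]
  have *: "tensor_lift s B (basis b \<otimes> q) = B (basis b) q" for b
    by (rule pm_linear_eqI [OF comp [OF linear_tensor_right linear_tensor_lift [OF s]] r])
      (simp add: tensor_lift_def lin_ext_basis [OF s])
  show ?thesis
    by (rule pm_linear_eqI [OF comp [OF linear_tensor_left linear_tensor_lift [OF s]] l]) (rule *)
qed

lemma tensor_universal:
  fixes B :: "('b \<Rightarrow>\<^sub>0 'k::field) \<Rightarrow> ('c \<Rightarrow>\<^sub>0 'k) \<Rightarrow> 'v::ab_group_add"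
  assumes s: "vector_space s"
    and l: "\<And>q. Vector_Spaces.linear smul s (\<lambda>p. B p q)"
    and r: "\<And>p. Vector_Spaces.linear smul s (B p)"
  shows "\<exists>!f. Vector_Spaces.linear smul s f \<and> (\<forall>p q. f (p \<otimes> q) = B p q)"
proof (rule ex1I [of _ "tensor_lift s B"])
  show "Vector_Spaces.linear smul s (tensor_lift s B) \<and> (\<forall>p q. tensor_lift s B (p \<otimes> q) = B p q)"
    using linear_tensor_lift [OF s] tensor_lift_tensor [OF s l r] by blast
next
  fix f assume f: "Vector_Spaces.linear smul s f \<and> (\<forall>p q. f (p \<otimes> q) = B p q)"
  show "f = tensor_lift s B"
  proof
    fix x show "f x = tensor_lift s B x"
    proof (rule pm_linear_eqI [OF _ linear_tensor_lift [OF s]])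
      fix b :: "'b \<times> 'c"
      obtain b1 b2 where b: "b = (b1, b2)" by fastforce
      show "f (basis b) = tensor_lift s B (basis b)"
        unfolding b tensor_basis [symmetric]
        using f by (simp only: tensor_lift_tensor [OF s l r])
    qed (use f in blast)
  qed
qed

lemma algebra_over_smul: "algebra_over (smul :: 'k::field \<Rightarrow> ('b::monoid_add \<Rightarrow>\<^sub>0 'k) \<Rightarrow> _)"
proof -
  have comm: "p * Poly_Mapping.single 0 c = Poly_Mapping.single 0 c * p"
    for c :: 'k and p :: "'b \<Rightarrow>\<^sub>0 'k"
    by (subst (1 2) poly_mapping_expand [of p])
      (simp add: sum_distrib_left sum_distrib_right mult_single mult.commute)
  have "smul c a * b = smul c (a * b)" "a * smul c b = smul c (a * b)"
    for c :: 'k and a b :: "'b \<Rightarrow>\<^sub>0 'k"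
    unfolding smul_conv_mult by (metis comm mult.assoc)+
  then show ?thesis
    by unfold_locales
qed

lemma algebra_over_field: "algebra_over ((*) :: 'k::field \<Rightarrow> 'k \<Rightarrow> 'k)"
  by unfold_locales (auto simp: algebra_simps)

lemma (in algebra_over) linear_mult_left: "Vector_Spaces.linear s s (\<lambda>a. a * b)"
  and linear_mult_right: "Vector_Spaces.linear s s (\<lambda>b. a * b)"
  unfolding Vector_Spaces.linear_iff
  by (simp_all add: vector_space_axioms scale_mult_left scale_mult_right algebra_simps)

lemma pm_multiplicativeI:
  fixes f :: "('b::monoid_add \<Rightarrow>\<^sub>0 'k::field) \<Rightarrow> 'a::ring_1"
  assumes s: "algebra_over s" and f: "Vector_Spaces.linear smul s f"
    and eq: "\<And>b c. f (basis (b + c)) = f (basis b) * f (basis c)"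
  shows "f (p * q) = f p * f q"
proof -
  note comp = Vector_Spaces.linear_compose [unfolded o_def]
  note A = algebra_over.linear_mult_left algebra_over.linear_mult_right
  note F = comp [OF A(1) [OF algebra_over_smul] f] comp [OF A(2) [OF algebra_over_smul] f]
    comp [OF f A(1) [OF s]] comp [OF f A(2) [OF s]]
  have *: "f (basis b * q) = f (basis b) * f q" for b
    by (rule pm_linear_eqI [OF F(2) F(4)]) (simp add: mult_single eq)
  show ?thesis
    by (rule pm_linear_eqI [OF F(1) F(3)]) (rule *)
qed

lemma tensor_times: "(a \<otimes> b) * (c \<otimes> d) = (a * c) \<otimes> (b * d)"
  for a b c d :: "'b::monoid_add \<Rightarrow>\<^sub>0 'k::field"
proof -
  note comp = Vector_Spaces.linear_compose [unfolded o_def]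
  note A = algebra_over.linear_mult_left [OF algebra_over_smul]
    algebra_over.linear_mult_right [OF algebra_over_smul]
  note T = linear_tensor_left linear_tensor_right
  have 1: "(basis i \<otimes> basis j) * (basis k \<otimes> d) = (basis i * basis k) \<otimes> (basis j * d)"
    for i j k :: 'b
    by (rule pm_linear_eqI [OF comp [OF T(2) A(2)] comp [OF A(2) T(2)]]) (simp add: mult_single)
  have 2: "(basis i \<otimes> basis j) * (c \<otimes> d) = (basis i * c) \<otimes> (basis j * d)"
    for i j :: 'b
    by (rule pm_linear_eqI [OF comp [OF T(1) A(2)] comp [OF A(2) T(1)]]) (rule 1)
  have 3: "(basis i \<otimes> b) * (c \<otimes> d) = (basis i * c) \<otimes> (b * d)" for i :: 'b
    by (rule pm_linear_eqI [OF comp [OF T(2) A(1)] comp [OF A(1) T(2)]]) (rule 2)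
  show ?thesis
    by (rule pm_linear_eqI [OF comp [OF T(1) A(1)] comp [OF A(1) T(1)]]) (rule 3)
qed

lemma one_tensor_one: "1 \<otimes> 1 = (1 :: 'b::monoid_add \<times> 'b \<Rightarrow>\<^sub>0 'k::field)"
  by (simp flip: single_one add: zero_prod_def)


section \<open>Coalgebras and Hopf algebras\<close>

text \<open>
  In Sweedler notation, coassociativity reads
  \<open>\<Sum> c\<^sub>1\<^sub>1 \<otimes> (c\<^sub>1\<^sub>2 \<otimes> c\<^sub>2) = \<Sum> c\<^sub>1 \<otimes> \<Delta>(c\<^sub>2)\<close>.
\<close>

locale coalgebra =
  fixes \<Delta> :: "('b \<Rightarrow>\<^sub>0 'k::field) \<Rightarrow> ('b \<times> 'b \<Rightarrow>\<^sub>0 'k)"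
    and \<epsilon> :: "('b \<Rightarrow>\<^sub>0 'k) \<Rightarrow> 'k"
  assumes comult_linear: "Vector_Spaces.linear smul smul \<Delta>"
    and counit_linear: "Vector_Spaces.linear smul (*) \<epsilon>"
    and coassoc:
      "tensor_lift smul (\<lambda>p q. tensor_lift smul (\<lambda>p1 p2. p1 \<otimes> (p2 \<otimes> q)) (\<Delta> p)) (\<Delta> c)
       = tensor_lift smul (\<lambda>p q. p \<otimes> \<Delta> q) (\<Delta> c)"
    and counit_left: "tensor_lift smul (\<lambda>p q. smul (\<epsilon> p) q) (\<Delta> c) = c"
    and counit_right: "tensor_lift smul (\<lambda>p q. smul (\<epsilon> q) p) (\<Delta> c) = c"

definition subcoalgebra ::
  "(('b \<Rightarrow>\<^sub>0 'k::field) \<Rightarrow> ('b \<times> 'b \<Rightarrow>\<^sub>0 'k)) \<Rightarrow> ('b \<Rightarrow>\<^sub>0 'k) set \<Rightarrow> bool" where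
  "subcoalgebra \<Delta> D \<longleftrightarrow> pm_subspace D \<and> (\<forall>d\<in>D. \<Delta> d \<in> tensor_space D D)"

definition simple_subcoalgebra ::
  "(('b \<Rightarrow>\<^sub>0 'k::field) \<Rightarrow> ('b \<times> 'b \<Rightarrow>\<^sub>0 'k)) \<Rightarrow> ('b \<Rightarrow>\<^sub>0 'k) set \<Rightarrow> bool" where
  "simple_subcoalgebra \<Delta> D \<longleftrightarrow>
     subcoalgebra \<Delta> D \<and> D \<noteq> {0} \<and> (\<forall>E. subcoalgebra \<Delta> E \<and> E \<subseteq> D \<longrightarrow> E = {0} \<or> E = D)"

definition coradical ::
  "(('b \<Rightarrow>\<^sub>0 'k::field) \<Rightarrow> ('b \<times> 'b \<Rightarrow>\<^sub>0 'k)) \<Rightarrow> ('b \<Rightarrow>\<^sub>0 'k) set" where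
  "coradical \<Delta> = pm_span (\<Union>{D. simple_subcoalgebra \<Delta> D})"

primrec coradical_filtration ::
  "(('b \<Rightarrow>\<^sub>0 'k::field) \<Rightarrow> ('b \<times> 'b \<Rightarrow>\<^sub>0 'k)) \<Rightarrow> nat \<Rightarrow> ('b \<Rightarrow>\<^sub>0 'k) set" where
  "coradical_filtration \<Delta> 0 = coradical \<Delta>"
| "coradical_filtration \<Delta> (Suc n) =
     \<Delta> -` subspace_sum (tensor_space UNIV (coradical_filtration \<Delta> n))
                      (tensor_space (coradical \<Delta>) UNIV)"

locale graded_coalgebra = coalgebra \<Delta> \<epsilon>
  for \<Delta> :: "('b \<Rightarrow>\<^sub>0 'k::field) \<Rightarrow> ('b \<times> 'b \<Rightarrow>\<^sub>0 'k)"
    and \<epsilon> :: "('b \<Rightarrow>\<^sub>0 'k) \<Rightarrow> 'k" +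
  fixes C :: "nat \<Rightarrow> ('b \<Rightarrow>\<^sub>0 'k) set"
  assumes decomposition: "direct_sum_decomposition C"
    and comult_graded:
      "c \<in> C n \<Longrightarrow> \<Delta> c \<in> pm_span (\<Union>i\<in>{0..n}. tensor_space (C i) (C (n - i)))"
    and counit_graded: "n \<ge> 1 \<Longrightarrow> c \<in> C n \<Longrightarrow> \<epsilon> c = 0"

locale coradically_graded_coalgebra = graded_coalgebra \<Delta> \<epsilon> C
  for \<Delta> :: "('b \<Rightarrow>\<^sub>0 'k::field) \<Rightarrow> ('b \<times> 'b \<Rightarrow>\<^sub>0 'k)"
    and \<epsilon> :: "('b \<Rightarrow>\<^sub>0 'k) \<Rightarrow> 'k"
    and C :: "nat \<Rightarrow> ('b \<Rightarrow>\<^sub>0 'k) set" +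
  assumes coradical_eq: "coradical_filtration \<Delta> 0 = C 0"
    and filtration_1_eq: "coradical_filtration \<Delta> 1 = subspace_sum (C 0) (C 1)"

text \<open>Hopf algebra structures on a monoid algebra, with its given multiplication.\<close>

locale hopf_algebra = coalgebra \<Delta> \<epsilon>
  for \<Delta> :: "('b::monoid_add \<Rightarrow>\<^sub>0 'k::field) \<Rightarrow> ('b \<times> 'b \<Rightarrow>\<^sub>0 'k)"
    and \<epsilon> :: "('b \<Rightarrow>\<^sub>0 'k) \<Rightarrow> 'k" +
  fixes S :: "('b \<Rightarrow>\<^sub>0 'k) \<Rightarrow> ('b \<Rightarrow>\<^sub>0 'k)"
  assumes comult_hom: "algebra_hom smul smul \<Delta>"
    and counit_hom: "algebra_hom smul (*) \<epsilon>"
    and antipode_linear: "Vector_Spaces.linear smul smul S"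
    and antipode_left: "tensor_lift smul (\<lambda>p q. S p * q) (\<Delta> c) = smul (\<epsilon> c) 1"
    and antipode_right: "tensor_lift smul (\<lambda>p q. p * S q) (\<Delta> c) = smul (\<epsilon> c) 1"

locale graded_hopf_algebra = hopf_algebra \<Delta> \<epsilon> S + graded_coalgebra \<Delta> \<epsilon> C
  for \<Delta> :: "('b::monoid_add \<Rightarrow>\<^sub>0 'k::field) \<Rightarrow> ('b \<times> 'b \<Rightarrow>\<^sub>0 'k)"
    and \<epsilon> :: "('b \<Rightarrow>\<^sub>0 'k) \<Rightarrow> 'k"
    and S :: "('b \<Rightarrow>\<^sub>0 'k) \<Rightarrow> ('b \<Rightarrow>\<^sub>0 'k)"
    and C :: "nat \<Rightarrow> ('b \<Rightarrow>\<^sub>0 'k) set" +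
  assumes one_graded: "1 \<in> C 0"
    and mult_graded: "a \<in> C m \<Longrightarrow> b \<in> C n \<Longrightarrow> a * b \<in> C (m + n)"
    and antipode_graded: "a \<in> C n \<Longrightarrow> S a \<in> C n"

locale coradically_graded_hopf_algebra =
  graded_hopf_algebra \<Delta> \<epsilon> S C + coradically_graded_coalgebra \<Delta> \<epsilon> C
  for \<Delta> :: "('b::monoid_add \<Rightarrow>\<^sub>0 'k::field) \<Rightarrow> ('b \<times> 'b \<Rightarrow>\<^sub>0 'k)"
    and \<epsilon> :: "('b \<Rightarrow>\<^sub>0 'k) \<Rightarrow> 'k"
    and S :: "('b \<Rightarrow>\<^sub>0 'k) \<Rightarrow> ('b \<Rightarrow>\<^sub>0 'k)"
    and C :: "nat \<Rightarrow> ('b \<Rightarrow>\<^sub>0 'k) set"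


section \<open>The algebra $F(t)$\<close>

text \<open>
  \<open>Xpow i\<close> stands for $x^i$ and \<open>Xpow_y i w\<close> for $x^i y w$, so that the elements of \<open>xy_word\<close> are
  exactly the monomials $x^{i_1} y x^{i_2} y \cdots y x^{i_{n+1}}$.  Their product is concatenation,
  written additively.  The monoid algebra \<open>xy_word \<Rightarrow>\<^sub>0 'k\<close> is the algebra
  $k\langle x^{\pm 1}, y\rangle$ with the relations $x x^{-1} = x^{-1} x = 1$ only: this
  is the universal property \<open>F_universal\<close> below.
\<close>

datatype xy_word = Xpow int | Xpow_y int xy_word

instantiation xy_word :: monoid_add
begin

definition zero_xy_word :: xy_word where
  "0 = Xpow 0"

fun plus_xy_word :: "xy_word \<Rightarrow> xy_word \<Rightarrow> xy_word" where
  "Xpow i + Xpow j = Xpow (i + j)"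
| "Xpow i + Xpow_y j w = Xpow_y (i + j) w"
| "Xpow_y i v + w = Xpow_y i (v + w)"

instance
proof
  fix a b c :: xy_word
  have *: "Xpow i + b + c = Xpow i + (b + c)" for i
    by (cases b; cases c) (simp_all add: add.assoc)
  show "a + b + c = a + (b + c)"
    by (induction a) (simp_all add: *)
  show "0 + a = a"
    by (cases a) (simp_all add: zero_xy_word_def)
  show "a + 0 = a"
    by (induction a) (simp_all add: zero_xy_word_def)
qed

end

type_synonym 'k F = "xy_word \<Rightarrow>\<^sub>0 'k"

definition F_x :: "int \<Rightarrow> 'k::field F" where
  "F_x i = basis (Xpow i)"

definition F_y :: "'k::field F" where
  "F_y = basis (Xpow_y 0 (Xpow 0))"

primrec y_degree :: "xy_word \<Rightarrow> nat" where
  "y_degree (Xpow i) = 0"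
| "y_degree (Xpow_y i w) = Suc (y_degree w)"

definition F_grade :: "nat \<Rightarrow> 'k::field F set" where
  "F_grade n = pm_span {basis w | w. y_degree w = n}"

text \<open>Here \<open>u'\<close> is meant to be the inverse of \<open>u\<close>.\<close>

definition unit_pow :: "'a::ring_1 \<Rightarrow> 'a \<Rightarrow> int \<Rightarrow> 'a" where
  "unit_pow u u' i = (if 0 \<le> i then u ^ nat i else u' ^ nat (- i))"

primrec word_eval :: "'a::ring_1 \<Rightarrow> 'a \<Rightarrow> 'a \<Rightarrow> xy_word \<Rightarrow> 'a" where
  "word_eval u u' v (Xpow i) = unit_pow u u' i"
| "word_eval u u' v (Xpow_y i w) = unit_pow u u' i * v * word_eval u u' v w"

text \<open>
  \<open>F_eval s u u' v\<close> is the algebra homomorphism given on generators by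
  $x \mapsto u$, $x^{-1} \mapsto u'$ and $y \mapsto v$.
\<close>

definition F_eval :: "('k::field \<Rightarrow> 'a::ring_1 \<Rightarrow> 'a) \<Rightarrow> 'a \<Rightarrow> 'a \<Rightarrow> 'a \<Rightarrow> 'k F \<Rightarrow> 'a" where
  "F_eval s u u' v = lin_ext s (word_eval u u' v)"

primrec word_rev :: "xy_word \<Rightarrow> xy_word" where
  "word_rev (Xpow i) = Xpow i"
| "word_rev (Xpow_y i w) = word_rev w + Xpow_y 0 (Xpow i)"

text \<open>
  \<open>F_rev\<close> is the anti-automorphism fixing $x$ and $y$; composed with an algebra homomorphism
  it gives the antihomomorphism with the same values on the generators.
\<close>

definition F_rev :: "'k::field F \<Rightarrow> 'k F" where
  "F_rev = lin_ext smul (\<lambda>w. basis (word_rev w))"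

definition F_comult :: "int \<Rightarrow> 'k::field F \<Rightarrow> (xy_word \<times> xy_word \<Rightarrow>\<^sub>0 'k)" where
  "F_comult t = F_eval smul (F_x 1 \<otimes> F_x 1) (F_x (-1) \<otimes> F_x (-1)) (F_y \<otimes> 1 + F_x t \<otimes> F_y)"

definition F_counit :: "'k::field F \<Rightarrow> 'k" where
  "F_counit = F_eval (*) 1 1 0"

definition F_antipode :: "int \<Rightarrow> 'k::field F \<Rightarrow> 'k F" where
  "F_antipode t = F_eval smul (F_x (-1)) (F_x 1) (- (F_x (- t) * F_y)) \<circ> F_rev"

subsection \<open>Universal property, and the structure maps on generators\<close>

lemma unit_pow_simps:
  "unit_pow u u' 0 = 1" "unit_pow u u' 1 = u" "unit_pow u u' (-1) = u'"
  by (simp_all add: unit_pow_def)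

lemma unit_pow_succ:
  assumes "u * u' = 1" "u' * u = 1"
  shows "unit_pow u u' (i + 1) = u * unit_pow u u' i"
proof (cases "i \<ge> 0")
  case True
  then show ?thesis by (simp add: unit_pow_def nat_add_distrib)
next
  case False
  then obtain n where n: "i = - int (Suc n)"
    by (cases i rule: int_cases) auto
  have "unit_pow u u' (i + 1) = u' ^ n"
  proof -
    have "i + 1 = - int n"
      by (simp add: n)
    then show ?thesis
      by (cases n) (simp_all add: unit_pow_def del: of_nat_Suc power_Suc)
  qed
  moreover have "unit_pow u u' i = u' ^ Suc n"
    by (simp add: n unit_pow_def nat_add_distrib)
  ultimately show ?thesis
    by (simp add: assms mult.assoc [symmetric])
qed

lemma unit_pow_add:
  assumes "u * u' = 1" "u' * u = 1"
  shows "unit_pow u u' (i + j) = unit_pow u u' i * unit_pow u u' j"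
proof (induction i rule: int_induct [where k = 0])
  case base
  then show ?case by (simp add: unit_pow_simps)
next
  case (step1 i)
  then show ?case
    using unit_pow_succ [OF assms, of "i + j"] unit_pow_succ [OF assms, of i]
    by (simp add: algebra_simps)
next
  case (step2 i)
  have "u * unit_pow u u' (i - 1 + j) = u * (unit_pow u u' (i - 1) * unit_pow u u' j)"
    using step2 unit_pow_succ [OF assms, of "i - 1 + j"] unit_pow_succ [OF assms, of "i - 1"]
    by (simp add: mult.assoc [symmetric])
  then have "u' * u * unit_pow u u' (i - 1 + j) = u' * u * (unit_pow u u' (i - 1) * unit_pow u u' j)"
    by (simp only: mult.assoc)
  then show ?case by (simp add: assms)
qed

lemma word_eval_add:
  assumes "u * u' = 1" "u' * u = 1"
  shows "word_eval u u' v (a + b) = word_eval u u' v a * word_eval u u' v b"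
proof (induction a)
  case (Xpow i)
  show ?case by (cases b) (simp_all add: unit_pow_add [OF assms] mult.assoc)
qed (simp add: mult.assoc)

lemma F_x_add: "F_x (i + j) = F_x i * F_x j"
  by (simp add: F_x_def mult_single)

lemma F_x_0: "F_x 0 = 1"
  by (simp add: F_x_def flip: single_one zero_xy_word_def)

lemma basis_Xpow_y: "basis (Xpow_y i w) = F_x i * F_y * basis w"
proof -
  have "Xpow 0 + w = w"
    by (cases w) simp_all
  then show ?thesis
    by (simp add: F_x_def F_y_def mult_single)
qed

lemma F_eval_basis: "vector_space s \<Longrightarrow> F_eval s u u' v (basis w) = word_eval u u' v w"
  by (simp add: F_eval_def lin_ext_basis)

lemma algebra_hom_F_eval:
  assumes s: "algebra_over s" and u: "u * u' = 1" "u' * u = 1"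
  shows "algebra_hom smul s (F_eval s u u' v)"
proof -
  interpret algebra_over s by fact
  have v: "vector_space s" by unfold_locales
  have lin: "Vector_Spaces.linear smul s (F_eval s u u' v)"
    unfolding F_eval_def by (rule linear_lin_ext [OF v])
  have "F_eval s u u' v 1 = 1"
    by (simp add: F_eval_basis [OF v] zero_xy_word_def unit_pow_simps flip: single_one)
  then show ?thesis
    unfolding algebra_hom_def
    using pm_multiplicativeI [OF s lin] lin by (simp add: F_eval_basis [OF v] word_eval_add [OF u])
qed

lemma F_eval_generators:
  assumes "vector_space s"
  shows "F_eval s u u' v (F_x 1) = u" "F_eval s u u' v (F_x (-1)) = u'" "F_eval s u u' v F_y = v"
  using assms by (simp_all add: F_x_def F_y_def F_eval_basis unit_pow_simps)

theorem F_universal: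
  fixes s :: "'k::field \<Rightarrow> 'a::ring_1 \<Rightarrow> 'a"
  assumes s: "algebra_over s" and u: "u * u' = 1" "u' * u = 1"
  shows "\<exists>!f. algebra_hom smul s f \<and> f (F_x 1) = u \<and> f (F_x (-1)) = u' \<and> f F_y = v"
proof (rule ex1I [of _ "F_eval s u u' v"])
  interpret algebra_over s by fact
  have v: "vector_space s" by unfold_locales
  show "algebra_hom smul s (F_eval s u u' v) \<and> F_eval s u u' v (F_x 1) = u \<and>
      F_eval s u u' v (F_x (-1)) = u' \<and> F_eval s u u' v F_y = v"
    using algebra_hom_F_eval [OF s u] F_eval_generators [OF v] by blast
  fix f assume f: "algebra_hom smul s f \<and> f (F_x 1) = u \<and> f (F_x (-1)) = u' \<and> f F_y = v"
  then have lin: "Vector_Spaces.linear smul s f" and mult: "\<And>a b. f (a * b) = f a * f b"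
    and one: "f 1 = 1"
    by (auto simp: algebra_hom_def)
  have pos: "f (F_x (int n)) = u ^ n" for n
    by (induction n) (use f in \<open>simp_all add: F_x_0 one F_x_add mult\<close>)
  have neg: "f (F_x (- int n)) = u' ^ n" for n
  proof (induction n)
    case (Suc n)
    have "F_x (- int (Suc n)) = F_x (-1) * (F_x (- int n) :: 'k F)"
      by (simp flip: F_x_add)
    then show ?case using Suc f by (simp add: mult)
  qed (simp add: F_x_0 one)
  have x: "f (F_x i) = unit_pow u u' i" for i
    using pos [of "nat i"] neg [of "nat (- i)"] by (auto simp: unit_pow_def)
  have "f (basis w) = word_eval u u' v w" for w
  proof (induction w)
    case (Xpow i)
    then show ?case using x by (simp add: F_x_def)
  next
    case (Xpow_y i w)
    then show ?case using x f by (simp add: basis_Xpow_y mult)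
  qed
  then show "f = F_eval s u u' v"
    using pm_linear_eqI [OF lin, of "F_eval s u u' v"] algebra_hom_F_eval [OF s u]
    by (auto simp: algebra_hom_def F_eval_basis [OF v])
qed

lemma F_x_inverse: "F_x 1 * F_x (-1) = 1" "F_x (-1) * F_x 1 = 1"
  by (simp_all add: F_x_0 flip: F_x_add)

lemma F_comult_hom: "algebra_hom smul smul (F_comult t)"
  unfolding F_comult_def
  by (rule algebra_hom_F_eval [OF algebra_over_smul])
    (simp_all add: tensor_times F_x_inverse one_tensor_one)

lemma F_comult_generators:
  "F_comult t (F_x 1) = F_x 1 \<otimes> F_x 1"
  "F_comult t F_y = F_y \<otimes> 1 + F_x t \<otimes> F_y"
  by (simp_all add: F_comult_def F_eval_generators [OF vector_space_smul])

lemma F_counit_hom: "algebra_hom smul (*) F_counit"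
  unfolding F_counit_def by (rule algebra_hom_F_eval [OF algebra_over_field]) simp_all

lemma F_counit_generators:
  "F_counit (F_x 1 :: 'k::field F) = 1" "F_counit (F_y :: 'k F) = 0"
proof -
  have "vector_space ((*) :: 'k \<Rightarrow> 'k \<Rightarrow> 'k)"
    by unfold_locales (auto simp: algebra_simps)
  then show "F_counit (F_x 1 :: 'k F) = 1" "F_counit (F_y :: 'k F) = 0"
    by (simp_all add: F_counit_def F_eval_generators)
qed

lemma word_rev_add: "word_rev (a + b) = word_rev b + word_rev a"
proof (induction a)
  case (Xpow i)
  have *: "Xpow_y 0 (Xpow (i + j)) = Xpow_y 0 (Xpow j) + Xpow i" for j
    by (simp add: add.commute)
  show ?case
  proof (cases b)
    case (Xpow_y j w)
    then show ?thesis
      by (simp add: * add.assoc)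
  qed (simp add: add.commute)
qed (simp add: add.assoc)

lemma F_antipode_linear: "Vector_Spaces.linear smul smul (F_antipode t)"
  unfolding F_antipode_def F_eval_def F_rev_def
  by (rule Vector_Spaces.linear_compose) (rule linear_lin_ext [OF vector_space_smul])+

lemma F_antipode_basis:
  "F_antipode t (basis w) = word_eval (F_x (-1)) (F_x 1) (- (F_x (- t) * F_y)) (word_rev w)"
  by (simp add: F_antipode_def F_rev_def lin_ext_basis [OF vector_space_smul]
      F_eval_basis [OF vector_space_smul])

lemma F_antipode_antihom:
  "F_antipode t 1 = 1" "F_antipode t (a * b) = F_antipode t b * F_antipode t a"
proof -
  show "F_antipode t 1 = 1"
    by (simp add: F_antipode_basis zero_xy_word_def unit_pow_simps flip: single_one)
  note comp = Vector_Spaces.linear_compose [unfolded o_def]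
  note A = algebra_over.linear_mult_left [OF algebra_over_smul]
    algebra_over.linear_mult_right [OF algebra_over_smul]
  have 1: "F_antipode t (basis v * basis w) = F_antipode t (basis w) * F_antipode t (basis v)"
    for v w
    by (simp add: mult_single F_antipode_basis word_rev_add word_eval_add F_x_inverse)
  have 2: "F_antipode t (basis v * b) = F_antipode t b * F_antipode t (basis v)" for v
    by (rule pm_linear_eqI [OF comp [OF A(2) F_antipode_linear] comp [OF F_antipode_linear A(1)]])
      (rule 1)
  show "F_antipode t (a * b) = F_antipode t b * F_antipode t a"
    by (rule pm_linear_eqI [OF comp [OF A(1) F_antipode_linear] comp [OF F_antipode_linear A(2)]])
      (rule 2)
qed

lemma F_antipode_generators:
  "F_antipode t (F_x 1) = F_x (-1)" "F_antipode t F_y = - (F_x (- t) * F_y)"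
proof -
  show "F_antipode t (F_x 1) = F_x (-1)"
    unfolding F_x_def [of 1] by (simp add: F_antipode_basis unit_pow_simps)
  show "F_antipode t F_y = - (F_x (- t) * F_y)"
    by (subst (1) F_y_def) (simp add: F_antipode_basis unit_pow_simps)
qed

end

theory Submission
  imports Defs
begin

text \<open>
  If \<open>D\<close> is a nonzero subcoalgebra and \<open>w\<close> a word of maximal degree in some \<open>d \<in> D\<close>, then the terms
  of \<open>\<Delta> d\<close> with right factor \<open>w\<close> have a power of \<open>x\<close> on the left, so that \<open>D\<close> contains a power of
  \<open>x\<close>.  Hence the simple subcoalgebras are the lines spanned by powers of \<open>x\<close>, and $H_0 = H(0)$.

  As $H_0$ is homogeneous, $H_1 = H(0) \oplus H(1)$ means that for \<open>n \<ge> 2\<close> no nonzero \<open>c \<in> H(n)\<close> has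
  vanishing components of \<open>\<Delta> c\<close> in all $H(i) \otimes H(n-i)$ with \<open>0 < i < n\<close>.  The component in
  $H(1) \otimes H(n-1)$ suffices: writing words as $v_{p_1} \cdots v_{p_n} x^s$ with
  $v_p = x^p y x^{-p}$, we have $\Delta(v_p) = v_p \otimes 1 + x^t \otimes v_p$ and
  $x^t v_p = v_{p+t} x^t$, so moving the \<open>j\<close>-th letter to the left factor raises
  $\sum_i p_i$ by \<open>t (j - 1)\<close>.  For a word of \<open>c\<close> with extremal $\sum_i p_i$ (minimal if \<open>t > 0\<close>,
  maximal if \<open>t < 0\<close>), the term that moves its first letter therefore cannot cancel.
\<close>

section \<open>Coordinate subspaces\<close>

text \<open>The graded pieces, their sums and their tensor products are all spanned by basis
  elements. Encoding such a subspace by a set of basis indices turns equalities of subspaces into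
  equalities of sets.\<close>

definition supported_on :: "'b set \<Rightarrow> ('b \<Rightarrow>\<^sub>0 'k::field) set" where
  "supported_on A = {p. Poly_Mapping.keys p \<subseteq> A}"

lemma supported_on_iff: "p \<in> supported_on A \<longleftrightarrow> (\<forall>b. b \<notin> A \<longrightarrow> Poly_Mapping.lookup p b = 0)"
  by (auto simp: supported_on_def in_keys_iff)

lemma subspace_supported_on: "pm_subspace (supported_on A)"
  by (auto simp: pm.subspace_def supported_on_iff lookup_add)

lemma basis_in_supported_on [simp]:
  "(basis b :: 'b \<Rightarrow>\<^sub>0 'k::field) \<in> supported_on A \<longleftrightarrow> b \<in> A"
  by (simp add: supported_on_def)

lemma supported_on_subsetI:
  fixes V :: "('b \<Rightarrow>\<^sub>0 'k::field) set"
  assumes "pm_subspace V" "\<And>b. b \<in> A \<Longrightarrow> basis b \<in> V"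
  shows "supported_on A \<subseteq> V"
proof
  fix p :: "'b \<Rightarrow>\<^sub>0 'k" assume "p \<in> supported_on A"
  then have "(\<Sum>b\<in>Poly_Mapping.keys p. smul (Poly_Mapping.lookup p b) (basis b)) \<in> V"
    by (intro pm.subspace_sum pm.subspace_scale assms) (auto simp: supported_on_def)
  then show "p \<in> V"
    by (simp only: poly_mapping_expand [symmetric])
qed

lemma span_basis: "pm_span {basis b | b. b \<in> A} = supported_on A"
proof
  show "pm_span {basis b | b. b \<in> A} \<subseteq> supported_on A"
    by (rule pm.span_minimal [OF _ subspace_supported_on]) auto
  show "supported_on A \<subseteq> pm_span {basis b | b. b \<in> A}"
    by (rule supported_on_subsetI) (auto intro: pm.span_base)
qed

lemma tensor_space_supported_on:
  "tensor_space (supported_on A) (supported_on B) = supported_on (A \<times> B)"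
proof
  show "tensor_space (supported_on A) (supported_on B) \<subseteq> supported_on (A \<times> B)"
    unfolding tensor_space_def
    by (rule pm.span_minimal [OF _ subspace_supported_on]) (auto simp: supported_on_iff)
  have "basis (a, b) \<in> tensor_space (supported_on A) (supported_on B)"
    if "a \<in> A" "b \<in> B" for a b
    unfolding tensor_space_def
    by (intro pm.span_base CollectI exI [of _ "basis a"] exI [of _ "basis b"]) (simp add: that)
  then show "supported_on (A \<times> B) \<subseteq> tensor_space (supported_on A) (supported_on B)"
    by (intro supported_on_subsetI) (auto simp: tensor_space_def)
qed

lemma subspace_sum_supported_on:
  "subspace_sum (supported_on A) (supported_on B)
    = (supported_on (A \<union> B) :: ('b \<Rightarrow>\<^sub>0 'k::field) set)"
proof
  show "subspace_sum (supported_on A) (supported_on B) \<subseteq> supported_on (A \<union> B)"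
    by (auto simp: subspace_sum_def supported_on_iff lookup_add)
  have 0: "(0 :: 'b \<Rightarrow>\<^sub>0 'k) \<in> supported_on C" for C
    by (rule pm.subspace_0 [OF subspace_supported_on])
  show "(supported_on (A \<union> B) :: ('b \<Rightarrow>\<^sub>0 'k) set) \<subseteq> subspace_sum (supported_on A) (supported_on B)"
  proof (rule supported_on_subsetI)
    show "pm_subspace (subspace_sum (supported_on A) (supported_on B) :: ('b \<Rightarrow>\<^sub>0 'k) set)"
      using pm.subspace_sums [OF subspace_supported_on subspace_supported_on]
      by (simp add: subspace_sum_def)
    fix b assume "b \<in> A \<union> B"
    then consider "b \<in> A" | "b \<in> B" by blast
    then show "(basis b :: 'b \<Rightarrow>\<^sub>0 'k) \<in> subspace_sum (supported_on A) (supported_on B)"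
    proof cases
      case 1
      show ?thesis
        unfolding subspace_sum_def
        by (rule CollectI, rule exI [of _ "basis b :: 'b \<Rightarrow>\<^sub>0 'k"], rule exI [of _ 0]) (simp add: 0 1)
    next
      case 2
      show ?thesis
        unfolding subspace_sum_def
        by (rule CollectI, rule exI [of _ 0], rule exI [of _ "basis b :: 'b \<Rightarrow>\<^sub>0 'k"]) (simp add: 0 2)
    qed
  qed
qed

lemma supported_on_UNIV: "supported_on UNIV = UNIV"
  by (simp add: supported_on_def)

text \<open>Applying id \<otimes> f, with f the coordinate functional at \<open>v\<close>, maps V
  \<otimes> W into V, and \<open>e\<close> is the image of \<open>P\<close>. The tensors for which
  such an \<open>e\<close> exists form a subspace containing every a \<otimes> b.\<close>

lemma tensor_space_slice:
  assumes V: "pm_subspace V" and P: "P \<in> tensor_space V W"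
  obtains e where "e \<in> V" "\<And>u. Poly_Mapping.lookup e u = Poly_Mapping.lookup P (u, v)"
proof -
  let ?S = "{P. \<exists>e\<in>V. \<forall>u. Poly_Mapping.lookup e u = Poly_Mapping.lookup P (u, v)}"
  have "pm_span {a \<otimes> b | a b. a \<in> V \<and> b \<in> W} \<subseteq> ?S"
  proof (rule pm.span_minimal)
    show "{a \<otimes> b | a b. a \<in> V \<and> b \<in> W} \<subseteq> ?S"
    proof safe
      fix a b assume "a \<in> V"
      then show "\<exists>e\<in>V. \<forall>u. Poly_Mapping.lookup e u = Poly_Mapping.lookup (a \<otimes> b) (u, v)"
        by (intro bexI [of _ "smul (Poly_Mapping.lookup b v) a"] pm.subspace_scale [OF V]) auto
    qed
    show "pm_subspace ?S"
    proof (rule pm.subspaceI)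
      show "0 \<in> ?S"
        using pm.subspace_0 [OF V] by (auto intro!: bexI [of _ 0])
    next
      fix P Q assume "P \<in> ?S" "Q \<in> ?S"
      then obtain e f where "e \<in> V" "f \<in> V"
        "\<forall>u. Poly_Mapping.lookup e u = Poly_Mapping.lookup P (u, v)"
        "\<forall>u. Poly_Mapping.lookup f u = Poly_Mapping.lookup Q (u, v)"
        by blast
      then show "P + Q \<in> ?S"
        by (auto intro!: bexI [of _ "e + f"] pm.subspace_add [OF V] simp: lookup_add)
    next
      fix c P assume "P \<in> ?S"
      then obtain e where "e \<in> V" "\<forall>u. Poly_Mapping.lookup e u = Poly_Mapping.lookup P (u, v)"
        by blast
      then show "smul c P \<in> ?S"
        by (auto intro!: bexI [of _ "smul c e"] pm.subspace_scale [OF V])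
    qed
  qed
  then show thesis
    using P that unfolding tensor_space_def by blast
qed

text \<open>By left cancellation, \<open>z\<close> is the only key that translation by
  \<open>a\<close> sends to \<open>a + z\<close>.\<close>

lemma lookup_basis_mult:
  fixes P :: "'b::monoid_add \<Rightarrow>\<^sub>0 'k::field"
  assumes "inj ((+) a)"
  shows "Poly_Mapping.lookup (basis a * P) (a + z) = Poly_Mapping.lookup P z"
proof -
  have "Poly_Mapping.lookup (basis a * P) (a + z)
      = Poly_Mapping.lookup (basis a * (\<Sum>b\<in>Poly_Mapping.keys P.
          smul (Poly_Mapping.lookup P b) (basis b))) (a + z)"
    by (simp only: poly_mapping_expand [symmetric])
  also have "\<dots> = (\<Sum>b\<in>Poly_Mapping.keys P. (Poly_Mapping.lookup P b when a + b = a + z))"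
    by (simp add: sum_distrib_left mult_single lookup_sum lookup_single)
  also have "\<dots> = (\<Sum>b\<in>Poly_Mapping.keys P. (Poly_Mapping.lookup P b when b = z))"
    using assms by (simp add: inj_eq)
  also have "\<dots> = Poly_Mapping.lookup P z"
    by (simp add: when_def in_keys_iff)
  finally show ?thesis .
qed

lemma keys_basis_mult:
  fixes P :: "'b::monoid_add \<Rightarrow>\<^sub>0 'k::field"
  shows "Poly_Mapping.keys (basis a * P) \<subseteq> (+) a ` Poly_Mapping.keys P"
  using keys_mult [of "basis a" P] by auto

section \<open>Words and their gradings\<close>

lemma F_grade_eq: "F_grade n = supported_on {w. y_degree w = n}"
  using span_basis [of "{w. y_degree w = n}"] by (simp add: F_grade_def)

lemma y_degree_add: "y_degree (v + w) = y_degree v + y_degree w"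
proof (induction v)
  case (Xpow i)
  show ?case by (cases w) simp_all
qed simp

lemma Xpow_plus_Xpow_plus: "Xpow i + (Xpow j + w) = Xpow (i + j) + w"
  by (simp flip: add.assoc)

lemma Xpow_0_plus [simp]: "Xpow 0 + w = w"
  by (cases w) simp_all

lemma Xpow_plus_cancel [simp]: "Xpow i + v = Xpow i + w \<longleftrightarrow> v = w"
proof
  assume "Xpow i + v = Xpow i + w"
  then have "Xpow (- i) + (Xpow i + v) = Xpow (- i) + (Xpow i + w)" by simp
  then show "v = w" by (simp add: Xpow_plus_Xpow_plus)
qed simp

lemma Xpow_plus_eq_Xpow [simp]: "Xpow i + v = Xpow a \<longleftrightarrow> v = Xpow (a - i)"
  by (cases v) auto

text \<open>This is the exponent s in the normal form of a word as a product of elements v_p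
  followed by x^s. It enters the power of x that remains in the left factor of \<Delta> when every
  letter y goes to the right.\<close>

primrec x_degree :: "xy_word \<Rightarrow> int" where
  "x_degree (Xpow i) = i"
| "x_degree (Xpow_y i w) = i + x_degree w"

text \<open>
  With $v_p = x^p y x^{-p}$, every word is uniquely $v_{p_1} \cdots v_{p_n} x^s$; its weight is
  $p_1 + \dots + p_n$.
\<close>

primrec weight :: "xy_word \<Rightarrow> int" where
  "weight (Xpow i) = 0"
| "weight (Xpow_y i w) = i * (1 + int (y_degree w)) + weight w"

text \<open>Since x^i v_p = v_{p+i} x^i, a prefix x^i raises each p_j by i.\<close>

lemma weight_Xpow_plus: "weight (Xpow i + w) = i * int (y_degree w) + weight w"
  by (cases w) (simp_all add: algebra_simps)

lemma direct_sum_F_grade: "direct_sum_decomposition (F_grade :: nat \<Rightarrow> 'k::field F set)"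
  unfolding direct_sum_decomposition_def
proof (intro conjI allI)
  show "pm_subspace (F_grade n :: 'k F set)" for n
    by (simp add: F_grade_eq subspace_supported_on)
  fix c :: "'k F"
  \<comment> \<open>Different grades have disjoint supports, so only the summand of index
    \<open>y_degree w\<close> reaches the coefficient of \<open>w\<close>. Existence and uniqueness
    both rest on this.\<close>
  have sum_eq: "Poly_Mapping.lookup (\<Sum>n\<in>Poly_Mapping.keys f. Poly_Mapping.lookup f n) w
      = Poly_Mapping.lookup (Poly_Mapping.lookup f (y_degree w)) w"
    if "\<forall>n. Poly_Mapping.lookup f n \<in> F_grade n" for f :: "nat \<Rightarrow>\<^sub>0 'k F" and w
  proof -
    have "Poly_Mapping.lookup (\<Sum>n\<in>Poly_Mapping.keys f. Poly_Mapping.lookup f n) w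
        = (\<Sum>n\<in>Poly_Mapping.keys f. if n = y_degree w
            then Poly_Mapping.lookup (Poly_Mapping.lookup f (y_degree w)) w else 0)"
      unfolding lookup_sum using that
      by (intro sum.cong) (auto simp: F_grade_eq supported_on_iff)
    then show ?thesis
      by (simp add: in_keys_iff)
  qed
  define f where "f = (\<Sum>w\<in>Poly_Mapping.keys c.
    Poly_Mapping.single (y_degree w) (Poly_Mapping.single w (Poly_Mapping.lookup c w)))"
  have f: "Poly_Mapping.lookup (Poly_Mapping.lookup f n) w
      = (if y_degree w = n then Poly_Mapping.lookup c w else 0)" for n w
  proof -
    have "Poly_Mapping.lookup (Poly_Mapping.lookup f n) w = (\<Sum>v\<in>Poly_Mapping.keys c.
        if v = w then (if y_degree w = n then Poly_Mapping.lookup c w else 0) else 0)"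
      unfolding f_def lookup_sum by (intro sum.cong) (auto simp: lookup_single when_def)
    then show ?thesis
      by (simp add: in_keys_iff)
  qed
  show "\<exists>!f. (\<forall>n. Poly_Mapping.lookup f n \<in> F_grade n) \<and>
      c = (\<Sum>n\<in>Poly_Mapping.keys f. Poly_Mapping.lookup f n)"
  proof (rule ex1I [of _ f])
    have grade: "\<forall>n. Poly_Mapping.lookup f n \<in> F_grade n"
      by (simp add: F_grade_eq supported_on_iff f)
    show "(\<forall>n. Poly_Mapping.lookup f n \<in> F_grade n) \<and>
        c = (\<Sum>n\<in>Poly_Mapping.keys f. Poly_Mapping.lookup f n)"
      using grade by (auto intro!: poly_mapping_eqI simp: sum_eq f)
    fix g assume g: "(\<forall>n. Poly_Mapping.lookup g n \<in> F_grade n) \<and>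
      c = (\<Sum>n\<in>Poly_Mapping.keys g. Poly_Mapping.lookup g n)"
    then have "Poly_Mapping.lookup c w
        = Poly_Mapping.lookup (Poly_Mapping.lookup g (y_degree w)) w" for w
      using sum_eq by metis
    then have "Poly_Mapping.lookup (Poly_Mapping.lookup g n) w
        = (if y_degree w = n then Poly_Mapping.lookup c w else 0)" for n w
      using g by (auto simp: F_grade_eq supported_on_iff)
    then show "g = f"
      by (intro poly_mapping_eqI) (simp add: f)
  qed
qed

lemma F_grade_mult: "a \<in> F_grade m \<Longrightarrow> b \<in> F_grade n \<Longrightarrow> a * b \<in> F_grade (m + n)"
  using keys_mult [of a b] unfolding F_grade_eq supported_on_def
  by (fastforce simp: y_degree_add)

lemma F_x_grade: "F_x i \<in> F_grade 0" and F_y_grade: "F_y \<in> F_grade 1"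
  by (simp_all add: F_x_def F_y_def F_grade_eq)

section \<open>The Hopf algebra structure\<close>

text \<open>This is the uniqueness in \<open>F_universal\<close>; that the images of x and x^{-1}
  are mutually inverse is inherited from \<open>f\<close>. It reduces coassociativity and the counit
  axioms to generators.\<close>

lemma F_hom_eqI:
  assumes s: "algebra_over s" and f: "algebra_hom smul s f" and g: "algebra_hom smul s g"
    and eq: "f (F_x 1) = g (F_x 1)" "f (F_x (-1)) = g (F_x (-1))" "f F_y = g F_y"
  shows "f c = g c"
proof -
  have "f (F_x 1) * f (F_x (-1)) = 1" "f (F_x (-1)) * f (F_x 1) = 1"
    using f F_x_inverse unfolding algebra_hom_def by metis+
  from F_universal [OF s this, of "f F_y"] have "f = g"
    using f g eq by metis
  then show ?thesis by simp
qed

lemma algebra_hom_comp: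
  assumes "algebra_hom s s' f" "algebra_hom s' s'' g"
  shows "algebra_hom s s'' (\<lambda>x. g (f x))"
  using assms Vector_Spaces.linear_compose [unfolded o_def]
  unfolding algebra_hom_def by metis

text \<open>\<open>tensor_lift\<close> is linear by construction and evaluates \<open>B\<close> only
  on basis elements, so products of basis elements decide multiplicativity.\<close>

lemma algebra_hom_tensor_liftI:
  fixes s :: "'k::field \<Rightarrow> 'a::ring_1 \<Rightarrow> 'a"
    and B :: "('b::monoid_add \<Rightarrow>\<^sub>0 'k) \<Rightarrow> ('c::monoid_add \<Rightarrow>\<^sub>0 'k) \<Rightarrow> 'a"
  assumes s: "algebra_over s"
    and one: "B 1 1 = 1"
    and mult: "\<And>b c b' c'. B (basis (b + b')) (basis (c + c'))
      = B (basis b) (basis c) * B (basis b') (basis c')"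
  shows "algebra_hom smul s (tensor_lift s B)"
proof -
  have v: "vector_space s"
    using s by (simp add: algebra_over_def)
  have lin: "Vector_Spaces.linear smul s (tensor_lift s B)"
    by (rule linear_tensor_lift [OF v])
  have basis: "tensor_lift s B (basis x) = B (basis (fst x)) (basis (snd x))" for x
    by (simp add: tensor_lift_def lin_ext_basis [OF v] case_prod_unfold)
  have "tensor_lift s B (p * q) = tensor_lift s B p * tensor_lift s B q" for p q
    by (rule pm_multiplicativeI [OF s lin]) (simp add: basis mult)
  moreover have "tensor_lift s B (basis 0) = 1"
    using one by (simp only: basis) (simp add: zero_prod_def)
  ultimately show ?thesis
    using lin by (simp add: algebra_hom_def)
qed

section \<open>Structure maps on powers of x\<close>

lemma F_x_power: "F_x i ^ n = F_x (i * int n)"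
  by (induction n) (simp_all add: F_x_0 algebra_simps flip: F_x_add)

lemma tensor_power: "(a \<otimes> b) ^ n = a ^ n \<otimes> b ^ n"
  for a b :: "'b::monoid_add \<Rightarrow>\<^sub>0 'k::field"
  by (induction n) (simp_all add: one_tensor_one tensor_times)

lemma F_comult_x: "F_comult t (F_x i) = F_x i \<otimes> F_x i"
proof -
  have "F_comult t (basis (Xpow i)) = F_x i \<otimes> F_x i"
    unfolding F_comult_def F_eval_basis [OF vector_space_smul]
    by (simp add: unit_pow_def tensor_power F_x_power)
  then show ?thesis
    by (simp only: F_x_def)
qed

lemma F_counit_x: "F_counit (F_x i :: 'k::field F) = 1"
proof -
  have "F_counit (F_x i :: 'k F) = unit_pow 1 1 i"
    unfolding F_counit_def F_x_def
    by (subst F_eval_basis) (use algebra_over_field in \<open>auto simp: algebra_over_def\<close>)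
  then show ?thesis by (simp add: unit_pow_def)
qed

lemma F_antipode_x: "F_antipode t (F_x i) = F_x (- i)"
  unfolding F_x_def [of i]
  by (simp add: F_antipode_basis unit_pow_def F_x_power)

lemma F_comult_linear: "Vector_Spaces.linear smul smul (F_comult t)"
  and F_comult_1: "F_comult t 1 = 1"
  and F_comult_mult: "F_comult t (a * b) = F_comult t a * F_comult t b"
  using F_comult_hom unfolding algebra_hom_def by blast+

lemma F_counit_linear: "Vector_Spaces.linear smul (*) F_counit"
  and F_counit_1: "F_counit 1 = 1"
  and F_counit_mult: "F_counit (a * b) = F_counit a * F_counit b"
  using F_counit_hom unfolding algebra_hom_def by blast+

lemmas linear_comp = Vector_Spaces.linear_compose [unfolded o_def]

lemma linear_smul: "Vector_Spaces.linear smul smul (\<lambda>p. smul c p)"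
  unfolding Vector_Spaces.linear_iff
  by (simp_all add: vector_space_smul pm.scale_right_distrib mult.commute)

lemma linear_smul_left:
  "Vector_Spaces.linear smul (*) f \<Longrightarrow> Vector_Spaces.linear smul smul (\<lambda>p. smul (f p) q)"
  unfolding Vector_Spaces.linear_iff
  by (simp add: vector_space_smul pm.scale_left_distrib)

lemma one_tensor_one_prod:
  "1 \<otimes> 1 = (1 :: 'b::monoid_add \<times> 'c::monoid_add \<Rightarrow>\<^sub>0 'k::field)"
  by (simp flip: single_one add: zero_prod_def)

lemmas linear_mult = algebra_over.linear_mult_left [OF algebra_over_smul]
  algebra_over.linear_mult_right [OF algebra_over_smul]

text \<open>The form of \<open>tensor_times\<close> for factors over two different monoids, as in H
  \<otimes> (H \<otimes> H). Both sides are linear in each argument, so basis elements are replaced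
  by general ones one argument at a time.\<close>

lemma tensor_times_prod: "(a \<otimes> b) * (c \<otimes> d) = (a * c) \<otimes> (b * d)"
  for a c :: "'b::monoid_add \<Rightarrow>\<^sub>0 'k::field" and b d :: "'c::monoid_add \<Rightarrow>\<^sub>0 'k"
proof -
  note T = linear_tensor_left linear_tensor_right
  have 1: "(basis i \<otimes> basis j) * (basis k \<otimes> d) = (basis i * basis k) \<otimes> (basis j * d)"
    for i k :: 'b and j :: 'c
    by (rule pm_linear_eqI [OF linear_comp [OF T(2) linear_mult(2)]
          linear_comp [OF linear_mult(2) T(2)]]) (simp add: mult_single)
  have 2: "(basis i \<otimes> basis j) * (c \<otimes> d) = (basis i * c) \<otimes> (basis j * d)"
    for i :: 'b and j :: 'c
    by (rule pm_linear_eqI [OF linear_comp [OF T(1) linear_mult(2)]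
          linear_comp [OF linear_mult(2) T(1)]]) (rule 1)
  have 3: "(basis i \<otimes> b) * (c \<otimes> d) = (basis i * c) \<otimes> (b * d)" for i :: 'b
    by (rule pm_linear_eqI [OF linear_comp [OF T(2) linear_mult(1)]
          linear_comp [OF linear_mult(1) T(2)]]) (rule 2)
  show ?thesis
    by (rule pm_linear_eqI [OF linear_comp [OF T(1) linear_mult(1)]
          linear_comp [OF linear_mult(1) T(1)]]) (rule 3)
qed

section \<open>Coassociativity and the counit axioms\<close>

lemma tensor_lift_assoc:
  "tensor_lift smul (\<lambda>p1 p2. p1 \<otimes> (p2 \<otimes> q)) (a \<otimes> b) = a \<otimes> (b \<otimes> q)"
  by (rule tensor_lift_tensor [OF vector_space_smul])
    (intro linear_tensor_left linear_comp [OF linear_tensor_left linear_tensor_right])+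

text \<open>Rebracketing respects products; the third factors \<open>p\<close> and \<open>q\<close>
  are held fixed. For \<open>P\<close> and \<open>Q\<close> in the image of \<Delta> this makes
  \<Delta> \<otimes> id multiplicative.\<close>

lemma tensor_lift_assoc_mult:
  fixes P Q :: "('b::monoid_add \<times> 'b) \<Rightarrow>\<^sub>0 'k::field"
  shows "tensor_lift smul (\<lambda>p1 p2. p1 \<otimes> (p2 \<otimes> (p * q))) (P * Q)
    = tensor_lift smul (\<lambda>p1 p2. p1 \<otimes> (p2 \<otimes> p)) P * tensor_lift smul (\<lambda>p1 p2. p1 \<otimes> (p2 \<otimes> q)) Q"
proof -
  note L = linear_tensor_lift [OF vector_space_smul]
  have 1: "tensor_lift smul (\<lambda>p1 p2. p1 \<otimes> (p2 \<otimes> (p * q))) (basis (a, b) * basis (c, d))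
    = tensor_lift smul (\<lambda>p1 p2. p1 \<otimes> (p2 \<otimes> p)) (basis (a, b))
      * tensor_lift smul (\<lambda>p1 p2. p1 \<otimes> (p2 \<otimes> q)) (basis (c, d))" for a b c d :: 'b
    by (simp only: tensor_basis [symmetric] tensor_times_prod tensor_lift_assoc)
  have 2: "tensor_lift smul (\<lambda>p1 p2. p1 \<otimes> (p2 \<otimes> (p * q))) (basis (a, b) * Q)
    = tensor_lift smul (\<lambda>p1 p2. p1 \<otimes> (p2 \<otimes> p)) (basis (a, b))
      * tensor_lift smul (\<lambda>p1 p2. p1 \<otimes> (p2 \<otimes> q)) Q" for a b :: 'b
    by (rule pm_linear_eqI [OF linear_comp [OF linear_mult(2) L] linear_comp [OF L linear_mult(2)]])
      (use 1 in auto)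
  show ?thesis
    by (rule pm_linear_eqI [OF linear_comp [OF linear_mult(1) L] linear_comp [OF L linear_mult(1)]])
      (use 2 in auto)
qed

text \<open>Both sides are \<Delta> followed by \<Delta> \<otimes> id or by id \<otimes> \<Delta>,
  hence algebra homomorphisms in \<open>c\<close>, and \<open>F_hom_eqI\<close> leaves the
  generators.\<close>

lemma F_coassoc:
  fixes c :: "'k::field F"
  shows "tensor_lift smul (\<lambda>p q. tensor_lift smul (\<lambda>p1 p2. p1 \<otimes> (p2 \<otimes> q)) (F_comult t p)) (F_comult t c)
   = tensor_lift smul (\<lambda>p q. p \<otimes> F_comult t q) (F_comult t c)"
proof (rule F_hom_eqI [where c = c, OF algebra_over_smul])
  let ?A = "\<lambda>p q :: 'k F. tensor_lift smul (\<lambda>p1 p2. p1 \<otimes> (p2 \<otimes> q)) (F_comult t p)"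
  let ?B = "\<lambda>p q :: 'k F. (p :: 'k F) \<otimes> F_comult t q"
  have A: "tensor_lift smul ?A (a \<otimes> b) = ?A a b" for a b :: "'k F"
  proof (rule tensor_lift_tensor [OF vector_space_smul])
    show "Vector_Spaces.linear smul smul (\<lambda>p. ?A p q)" for q
      by (intro linear_comp [OF F_comult_linear] linear_tensor_lift vector_space_smul)
    fix p
    show "Vector_Spaces.linear smul smul (?A p)"
      unfolding tensor_lift_def lin_ext_def
      by (auto simp: Vector_Spaces.linear_iff vector_space_smul case_prod_unfold tensor_add_right
          tensor_smul_right pm.scale_right_distrib sum.distrib pm.scale_sum_right mult.commute)
  qed
  have B: "tensor_lift smul ?B (a \<otimes> b) = ?B a b" for a b :: "'k F"
    by (rule tensor_lift_tensor [OF vector_space_smul])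
      (intro linear_tensor_left linear_comp [OF F_comult_linear linear_tensor_right])+
  show "algebra_hom smul smul (\<lambda>c. tensor_lift smul ?A (F_comult t c))"
  proof (intro algebra_hom_comp [OF F_comult_hom] algebra_hom_tensor_liftI algebra_over_smul)
    show "?A 1 1 = 1"
      using tensor_lift_assoc [of "1 :: 'k F" "1 :: 'k F" "1 :: 'k F"] by (simp only: F_comult_1 one_tensor_one_prod)
    show "?A (basis (b + b')) (basis (c + c')) = ?A (basis b) (basis c) * ?A (basis b') (basis c')"
      for b c b' c'
      using tensor_lift_assoc_mult [of "basis c" "basis c'" "F_comult t (basis b)"
          "F_comult t (basis b')"]
      by (simp add: mult_single flip: F_comult_mult)
  qed
  show "algebra_hom smul smul (\<lambda>c. tensor_lift smul ?B (F_comult t c))"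
  proof (intro algebra_hom_comp [OF F_comult_hom] algebra_hom_tensor_liftI algebra_over_smul)
    show "?B 1 1 = 1"
      by (simp only: F_comult_1 one_tensor_one_prod)
    show "?B (basis (b + b')) (basis (c + c')) = ?B (basis b) (basis c) * ?B (basis b') (basis c')"
      for b c b' c'
      by (simp add: tensor_times_prod mult_single flip: F_comult_mult)
  qed
  have x: "tensor_lift smul ?A (F_comult t (F_x i)) = tensor_lift smul ?B (F_comult t (F_x i))" for i
    by (simp only: F_comult_x A B tensor_lift_assoc)
  show "tensor_lift smul ?A (F_comult t (F_x 1)) = tensor_lift smul ?B (F_comult t (F_x 1))"
    "tensor_lift smul ?A (F_comult t (F_x (-1))) = tensor_lift smul ?B (F_comult t (F_x (-1)))"
    by (rule x)+
  have add: "tensor_lift smul X (p + q) = tensor_lift smul X p + tensor_lift smul X q"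
    for X :: "'k F \<Rightarrow> 'k F \<Rightarrow> xy_word \<times> xy_word \<times> xy_word \<Rightarrow>\<^sub>0 'k" and p q
    using linear_tensor_lift [OF vector_space_smul, of X] by (simp add: Vector_Spaces.linear_iff)
  \<comment> \<open>Both sides are y \<otimes> 1 \<otimes> 1 + x^t \<otimes> y \<otimes> 1 + x^t
    \<otimes> x^t \<otimes> y.\<close>
  show "tensor_lift smul ?A (F_comult t F_y) = tensor_lift smul ?B (F_comult t F_y)"
    by (simp only: F_comult_generators F_comult_x F_comult_1 A B tensor_lift_assoc add
        one_tensor_one_prod [symmetric] tensor_add_right add.assoc)
qed

text \<open>Both left-hand sides are algebra homomorphisms in \<open>c\<close>, and so is the
  identity; they are compared on the generators.\<close>

lemma
  fixes c :: "'a::field F"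
  shows F_counit_left: "tensor_lift smul (\<lambda>p q. smul (F_counit p) q) (F_comult t c) = c"
  and F_counit_right: "tensor_lift smul (\<lambda>p q. smul (F_counit q) p) (F_comult t c) = c"
proof -
  let ?L = "\<lambda>p q :: 'a F. smul (F_counit p) q" and ?R = "\<lambda>p q :: 'a F. smul (F_counit q) p"
  have L: "tensor_lift smul ?L (a \<otimes> b) = ?L a b" and R: "tensor_lift smul ?R (a \<otimes> b) = ?R a b"
    for a b :: "'a F"
    by (rule tensor_lift_tensor [OF vector_space_smul],
        (intro linear_smul linear_smul_left F_counit_linear)+)+
  have add: "tensor_lift smul X (p + q) = tensor_lift smul X p + tensor_lift smul X q"
    for X :: "'a F \<Rightarrow> 'a F \<Rightarrow> 'a F" and p q
    using linear_tensor_lift [OF vector_space_smul, of X] by (simp add: Vector_Spaces.linear_iff)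
  have \<epsilon>: "F_counit (basis (v + w)) = F_counit (basis v) * (F_counit (basis w) :: 'a)" for v w
    by (simp add: mult_single flip: F_counit_mult)
  have hom_L: "algebra_hom smul smul (\<lambda>c. tensor_lift smul ?L (F_comult t c))"
    by (intro algebra_hom_comp [OF F_comult_hom] algebra_hom_tensor_liftI algebra_over_smul)
      (simp_all add: F_counit_1 \<epsilon> mult_single)
  have hom_R: "algebra_hom smul smul (\<lambda>c. tensor_lift smul ?R (F_comult t c))"
    by (intro algebra_hom_comp [OF F_comult_hom] algebra_hom_tensor_liftI algebra_over_smul)
      (simp_all add: F_counit_1 \<epsilon> mult_single)
  have hom_id: "algebra_hom smul smul (\<lambda>c :: 'a F. c)"
    by (simp add: algebra_hom_def Vector_Spaces.linear_iff vector_space_smul)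
  show "tensor_lift smul ?L (F_comult t c) = c"
    by (rule F_hom_eqI [where c = c, OF algebra_over_smul hom_L hom_id])
      (simp_all only: F_comult_x F_comult_generators add L F_counit_x F_counit_generators,
        simp_all)
  show "tensor_lift smul ?R (F_comult t c) = c"
    by (rule F_hom_eqI [where c = c, OF algebra_over_smul hom_R hom_id])
      (simp_all only: F_comult_x F_comult_generators add R F_counit_x F_counit_generators F_counit_1,
        simp_all)
qed

text \<open>Meant for the antipode axioms: S reverses products, so these are not equalities of
  algebra homomorphisms and \<open>F_hom_eqI\<close> does not apply. They are instead passed from
  two factors to their product.\<close>

lemma F_word_induct:
  assumes "\<And>i. P (F_x i)" "P F_y" "\<And>a b. P a \<Longrightarrow> P b \<Longrightarrow> P (a * b)"
  shows "P (basis w)"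
proof (induction w)
  case (Xpow i)
  then show ?case using assms(1) [of i] by (simp add: F_x_def)
next
  case (Xpow_y i w)
  then show ?case unfolding basis_Xpow_y by (intro assms)
qed

text \<open>
  The antipode is antimultiplicative, so for \<open>\<Delta> (a * b) = \<Delta> a * \<Delta> b\<close> the antipode sum of one factor
  occurs inside that of the other, where it is a scalar: the antipode axioms pass to products.
\<close>

lemma antipode_lift_tensor:
  "tensor_lift smul (\<lambda>p q. F_antipode t p * q) (a \<otimes> b) = F_antipode t a * b"
  "tensor_lift smul (\<lambda>p q. p * F_antipode t q) (a \<otimes> b) = a * F_antipode t b"
  by (rule tensor_lift_tensor [OF vector_space_smul],
      (intro linear_comp [OF F_antipode_linear] linear_mult)+)+

lemma antipode_lift_mult_left:
  "tensor_lift smul (\<lambda>p q. F_antipode t p * q) (P * (a \<otimes> b))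
    = F_antipode t a * tensor_lift smul (\<lambda>p q. F_antipode t p * q) P * b"
proof (rule pm_linear_eqI [OF linear_comp [OF linear_mult(1) linear_tensor_lift [OF vector_space_smul]]
      linear_comp [OF linear_comp [OF linear_tensor_lift [OF vector_space_smul] linear_mult(2)]
        linear_mult(1)]])
  fix x
  show "tensor_lift smul (\<lambda>p q. F_antipode t p * q) (basis x * (a \<otimes> b))
    = F_antipode t a * tensor_lift smul (\<lambda>p q. F_antipode t p * q) (basis x) * b"
    by (cases x) (simp only: tensor_basis [symmetric] tensor_times antipode_lift_tensor
        F_antipode_antihom mult.assoc)
qed

lemma antipode_lift_mult_right:
  "tensor_lift smul (\<lambda>p q. p * F_antipode t q) ((a \<otimes> b) * P)
    = a * tensor_lift smul (\<lambda>p q. p * F_antipode t q) P * F_antipode t b"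
proof (rule pm_linear_eqI [OF linear_comp [OF linear_mult(2) linear_tensor_lift [OF vector_space_smul]]
      linear_comp [OF linear_comp [OF linear_tensor_lift [OF vector_space_smul] linear_mult(2)]
        linear_mult(1)]])
  fix x
  show "tensor_lift smul (\<lambda>p q. p * F_antipode t q) ((a \<otimes> b) * basis x)
    = a * tensor_lift smul (\<lambda>p q. p * F_antipode t q) (basis x) * F_antipode t b"
    by (cases x) (simp only: tensor_basis [symmetric] tensor_times antipode_lift_tensor
        F_antipode_antihom mult.assoc)
qed

lemma F_antipode_left:
  fixes c :: "'k::field F"
  shows "tensor_lift smul (\<lambda>p q. F_antipode t p * q) (F_comult t c) = smul (F_counit c) 1"
proof -
  let ?M = "\<lambda>p q :: 'k F. F_antipode t p * q"
  note M = linear_tensor_lift [OF vector_space_smul, of ?M]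
  have add: "tensor_lift smul ?M (p + q) = tensor_lift smul ?M p + tensor_lift smul ?M q" for p q
    using M by (simp add: Vector_Spaces.linear_iff)
  have *: "tensor_lift smul ?M (F_comult t (basis w)) = smul (F_counit (basis w)) 1" for w
  proof (rule F_word_induct)
    show "tensor_lift smul ?M (F_comult t (F_x i)) = smul (F_counit (F_x i)) 1" for i
      by (simp only: F_comult_x antipode_lift_tensor F_antipode_x F_counit_x)
        (simp add: F_x_0 flip: F_x_add)
    \<comment> \<open>S(y) 1 + S(x^t) y = - x^{-t} y + x^{-t} y = 0.\<close>
    show "tensor_lift smul ?M (F_comult t F_y) = smul (F_counit F_y) 1"
      by (simp only: F_comult_generators add antipode_lift_tensor F_antipode_x
          F_antipode_generators F_counit_generators) simp
    fix a b
    assume a: "tensor_lift smul ?M (F_comult t a) = smul (F_counit a) 1"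
      and b: "tensor_lift smul ?M (F_comult t b) = smul (F_counit b) 1"
    \<comment> \<open>The case \<open>Q = F_comult t b\<close> is the one wanted. A general
      \<open>Q\<close> permits linear extension from basis tensors, where the inner sum over
      \<Delta> a is the scalar \<epsilon>(a).\<close>
    have "tensor_lift smul ?M (F_comult t a * Q) = smul (F_counit a) (tensor_lift smul ?M Q)" for Q
    proof (rule pm_linear_eqI [OF linear_comp [OF linear_mult(2) M] linear_comp [OF M linear_smul]])
      fix x
      show "tensor_lift smul ?M (F_comult t a * basis x)
          = smul (F_counit a) (tensor_lift smul ?M (basis x))"
        by (cases x) (simp only: tensor_basis [symmetric] antipode_lift_mult_left a
            antipode_lift_tensor algebra_over.scale_mult_right [OF algebra_over_smul]
            algebra_over.scale_mult_left [OF algebra_over_smul] mult_1_right)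
    qed
    then show "tensor_lift smul ?M (F_comult t (a * b)) = smul (F_counit (a * b)) 1"
      by (simp add: F_comult_mult F_counit_mult b)
  qed
  show ?thesis
    by (rule pm_linear_eqI [OF linear_comp [OF F_comult_linear M]
          linear_smul_left [OF F_counit_linear]]) (rule *)
qed

text \<open>Mirror image of \<open>F_antipode_left\<close>: in the sum for a product, that of the
  second factor \<open>b\<close> is now the inner one.\<close>

lemma F_antipode_right:
  fixes c :: "'k::field F"
  shows "tensor_lift smul (\<lambda>p q. p * F_antipode t q) (F_comult t c) = smul (F_counit c) 1"
proof -
  let ?M = "\<lambda>p q :: 'k F. p * F_antipode t q"
  note M = linear_tensor_lift [OF vector_space_smul, of ?M]
  have add: "tensor_lift smul ?M (p + q) = tensor_lift smul ?M p + tensor_lift smul ?M q" for p q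
    using M by (simp add: Vector_Spaces.linear_iff)
  have *: "tensor_lift smul ?M (F_comult t (basis w)) = smul (F_counit (basis w)) 1" for w
  proof (rule F_word_induct)
    show "tensor_lift smul ?M (F_comult t (F_x i)) = smul (F_counit (F_x i)) 1" for i
      by (simp only: F_comult_x antipode_lift_tensor F_antipode_x F_counit_x)
        (simp add: F_x_0 flip: F_x_add)
    \<comment> \<open>y S(1) + x^t S(y) = y - x^t x^{-t} y = 0.\<close>
    show "tensor_lift smul ?M (F_comult t F_y) = smul (F_counit F_y) 1"
      by (simp only: F_comult_generators add antipode_lift_tensor F_antipode_antihom
          F_antipode_generators F_counit_generators)
        (simp add: F_x_0 flip: F_x_add mult.assoc)
    fix a b
    assume a: "tensor_lift smul ?M (F_comult t a) = smul (F_counit a) 1"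
      and b: "tensor_lift smul ?M (F_comult t b) = smul (F_counit b) 1"
    have "tensor_lift smul ?M (P * F_comult t b) = smul (F_counit b) (tensor_lift smul ?M P)" for P
    proof (rule pm_linear_eqI [OF linear_comp [OF linear_mult(1) M] linear_comp [OF M linear_smul]])
      fix x
      show "tensor_lift smul ?M (basis x * F_comult t b)
          = smul (F_counit b) (tensor_lift smul ?M (basis x))"
        by (cases x) (simp only: tensor_basis [symmetric] antipode_lift_mult_right b
            antipode_lift_tensor algebra_over.scale_mult_right [OF algebra_over_smul]
            algebra_over.scale_mult_left [OF algebra_over_smul] mult_1_right)
    qed
    then show "tensor_lift smul ?M (F_comult t (a * b)) = smul (F_counit (a * b)) 1"
      by (simp add: F_comult_mult F_counit_mult a mult.commute)
  qed
  show ?thesis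
    by (rule pm_linear_eqI [OF linear_comp [OF F_comult_linear M]
          linear_smul_left [OF F_counit_linear]]) (rule *)
qed

text \<open>S reverses products and sends x^i to x^{-i} and y to - x^{-t} y, which preserves the
  degree of every word.\<close>

lemma F_antipode_grade: "(a :: 'a::field F) \<in> F_grade n \<Longrightarrow> F_antipode t a \<in> F_grade n"
proof -
  have w: "F_antipode t (basis w :: 'a F) \<in> F_grade (y_degree w)" for w
  proof (induction w)
    case (Xpow i)
    then show ?case
      using F_antipode_x [of t i, where 'a = 'a] F_x_grade [of "- i", where 'a = 'a]
      by (simp add: F_x_def)
  next
    case (Xpow_y i w)
    have "- (F_x (- t) * F_y) \<in> F_grade (0 + 1)"
      unfolding F_grade_eq
      by (rule pm.subspace_neg [OF subspace_supported_on])
        (use F_grade_mult [OF F_x_grade F_y_grade] in \<open>simp add: F_grade_eq\<close>)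
    with F_grade_mult [OF Xpow_y F_grade_mult [OF this F_x_grade]] show ?case
      by (simp add: basis_Xpow_y F_antipode_antihom F_antipode_x F_antipode_generators)
  qed
  interpret S: Vector_Spaces.linear smul smul "F_antipode t :: 'a F \<Rightarrow> _"
    by (rule F_antipode_linear)
  assume "a \<in> F_grade n"
  moreover have "supported_on {w. y_degree w = n} \<subseteq> F_antipode t -` (F_grade n :: 'a F set)"
    by (rule supported_on_subsetI)
      (use w in \<open>auto simp: F_grade_eq intro: S.subspace_vimage subspace_supported_on\<close>)
  ultimately show "F_antipode t a \<in> F_grade n"
    by (auto simp: F_grade_eq)
qed

section \<open>Coefficients of the comultiplication\<close>

lemma F_comult_Xpow: "F_comult t (basis (Xpow i)) = basis (Xpow i, Xpow i)"
  using F_comult_x [of t i] by (simp add: F_x_def)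

text \<open>The first letter goes to the left factor in one summand and to the right factor in the
  other, where it leaves an extra x^t on the left.\<close>

lemma F_comult_Xpow_y:
  "F_comult t (basis (Xpow_y i w)) = basis (Xpow_y i 0, Xpow i) * F_comult t (basis w)
    + basis (Xpow (i + t), Xpow_y i 0) * F_comult t (basis w)"
proof -
  have "F_comult t (basis (Xpow_y i w)) =
      (F_x i \<otimes> F_x i) * (F_y \<otimes> 1 + F_x t \<otimes> F_y) * F_comult t (basis w)"
    by (simp only: basis_Xpow_y F_comult_mult F_comult_x F_comult_generators)
  also have "(F_x i \<otimes> F_x i) * (F_y \<otimes> 1 + F_x t \<otimes> F_y)
      = (F_x i * F_y) \<otimes> F_x i + F_x (i + t) \<otimes> (F_x i * F_y)"
    by (simp add: distrib_left tensor_times F_x_add)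
  also have "\<dots> = basis (Xpow_y i 0, Xpow i) + basis (Xpow (i + t), Xpow_y i 0)"
    by (simp add: F_x_def F_y_def mult_single zero_xy_word_def)
  finally show ?thesis
    by (simp add: distrib_right)
qed

lemma inj_plus_word: "inj ((+) (w :: xy_word))"
proof (rule injI)
  show "u = v" if "w + u = w + v" for u v
    using that by (induction w) simp_all
qed

lemma inj_plus_word_pair: "inj ((+) (x :: xy_word \<times> xy_word))"
  using inj_plus_word by (auto simp: inj_def plus_prod_def prod_eq_iff)

text \<open>Coefficient form of \<open>F_comult_Xpow_y\<close>: left cancellation strips the prefix
  from each summand, and a pair without that prefix gets 0.\<close>

lemma lookup_comult_Xpow_y:
  "Poly_Mapping.lookup (F_comult t (basis (Xpow_y i w))) (u, v) =
    (case u of Xpow a \<Rightarrow> 0 | Xpow_y j u' \<Rightarrow>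
      if j = i then Poly_Mapping.lookup (F_comult t (basis w)) (u', Xpow (- i) + v) else 0) +
    (case v of Xpow a \<Rightarrow> 0 | Xpow_y j v' \<Rightarrow>
      if j = i then Poly_Mapping.lookup (F_comult t (basis w)) (Xpow (- i - t) + u, v') else 0)"
proof -
  have z: "Poly_Mapping.lookup (basis x * P) y = 0" if "y \<notin> range ((+) x)" for x y and P :: "_ \<Rightarrow>\<^sub>0 'a"
    using that keys_basis_mult [of x P] by (auto simp: in_keys_iff)
  have 1: "Poly_Mapping.lookup (basis (Xpow_y i 0, Xpow i) * P) (u, v) =
    (case u of Xpow a \<Rightarrow> 0 | Xpow_y j u' \<Rightarrow>
      if j = i then Poly_Mapping.lookup P (u', Xpow (- i) + v) else 0)" for P :: "_ \<Rightarrow>\<^sub>0 'a"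
  proof (cases "\<exists>u'. u = Xpow_y i u'")
    case True
    then obtain u' where "u = Xpow_y i u'" by blast
    then show ?thesis
      using lookup_basis_mult [OF inj_plus_word_pair,
          of "(Xpow_y i 0, Xpow i)" P "(u', Xpow (- i) + v)"]
      by (simp add: Xpow_plus_Xpow_plus)
  next
    case False
    then show ?thesis
      by (subst z) (auto split: xy_word.splits)
  qed
  have 2: "Poly_Mapping.lookup (basis (Xpow (i + t), Xpow_y i 0) * P) (u, v) =
    (case v of Xpow a \<Rightarrow> 0 | Xpow_y j v' \<Rightarrow>
      if j = i then Poly_Mapping.lookup P (Xpow (- i - t) + u, v') else 0)" for P :: "_ \<Rightarrow>\<^sub>0 'a"
  proof (cases "\<exists>v'. v = Xpow_y i v'")
    case True
    then obtain v' where "v = Xpow_y i v'" by blast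
    then show ?thesis
      using lookup_basis_mult [OF inj_plus_word_pair,
          of "(Xpow (i + t), Xpow_y i 0)" P "(Xpow (- i - t) + u, v')"]
      by (simp add: Xpow_plus_Xpow_plus)
  next
    case False
    then show ?thesis
      by (subst z) (auto split: xy_word.splits)
  qed
  show ?thesis
    by (simp only: F_comult_Xpow_y lookup_add 1 2)
qed

lemma comult_Xpow_y_cases:
  assumes "Poly_Mapping.lookup (F_comult t (basis (Xpow_y i w) :: 'k::field F)) (u, v) \<noteq> 0"
  obtains (left) u' where "u = Xpow_y i u'"
      "Poly_Mapping.lookup (F_comult t (basis w :: 'k F)) (u', Xpow (- i) + v) \<noteq> 0"
    | (right) v' where "v = Xpow_y i v'"
      "Poly_Mapping.lookup (F_comult t (basis w :: 'k F)) (Xpow (- i - t) + u, v') \<noteq> 0"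
proof -
  from assms have "(\<exists>u'. u = Xpow_y i u' \<and>
      Poly_Mapping.lookup (F_comult t (basis w :: 'k F)) (u', Xpow (- i) + v) \<noteq> 0) \<or>
    (\<exists>v'. v = Xpow_y i v' \<and>
      Poly_Mapping.lookup (F_comult t (basis w :: 'k F)) (Xpow (- i - t) + u, v') \<noteq> 0)"
    unfolding lookup_comult_Xpow_y
    by (cases u; cases v) (auto split: if_splits)
  then show thesis
    using left right by blast
qed

text \<open>Each letter y goes to exactly one of the two factors.\<close>

lemma comult_degree:
  "Poly_Mapping.lookup (F_comult t (basis w)) (u, v) \<noteq> 0 \<Longrightarrow> y_degree u + y_degree v = y_degree w"
proof (induction w arbitrary: u v)
  case (Xpow i)
  then show ?case
    by (auto simp: F_comult_Xpow lookup_single when_def split: if_splits)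
next
  case (Xpow_y i w)
  from Xpow_y.prems show ?case
    by (cases rule: comult_Xpow_y_cases) (auto dest!: Xpow_y.IH simp: y_degree_add)
qed

text \<open>
  Here \<open>k\<close> counts the pairs of letters \<open>y\<close> put in the wrong order, since $x^t v_p = v_{p+t} x^t$.
\<close>

lemma comult_weight:
  "Poly_Mapping.lookup (F_comult t (basis w)) (u, v) \<noteq> 0 \<Longrightarrow>
    \<exists>k::nat. weight u + weight v = weight w + t * int k"
proof (induction w arbitrary: u v)
  case (Xpow i)
  then show ?case
    by (auto simp: F_comult_Xpow lookup_single when_def split: if_splits intro: exI [of _ 0])
next
  case (Xpow_y i w)
  from Xpow_y.prems show ?case
  proof (cases rule: comult_Xpow_y_cases)
    case (left u')
    obtain k :: nat where "weight u' + weight (Xpow (- i) + v) = weight w + t * int k"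
      using Xpow_y.IH [OF left(2)] by blast
    moreover have "int (y_degree w) = int (y_degree u') + int (y_degree v)"
      using comult_degree [OF left(2)] by (simp add: y_degree_add)
    ultimately show ?thesis
      by (intro exI [of _ k]) (simp add: left(1) weight_Xpow_plus algebra_simps)
  next
    case (right v')
    obtain k :: nat where "weight (Xpow (- i - t) + u) + weight v' = weight w + t * int k"
      using Xpow_y.IH [OF right(2)] by blast
    moreover have "int (y_degree w) = int (y_degree u) + int (y_degree v')"
      using comult_degree [OF right(2)] by (simp add: y_degree_add)
    ultimately show ?thesis
      \<comment> \<open>The first letter goes right, so it forms a wrongly ordered pair with each of
        the \<open>y_degree u\<close> letters on the left.\<close>
      by (intro exI [of _ "k + y_degree u"]) (simp add: right(1) weight_Xpow_plus algebra_simps)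
  qed
qed

text \<open>A power of x on the left forces every letter to the right. That is a single term, in
  which each letter contributes one x^t to the left.\<close>

lemma lookup_comult_Xpow:
  "Poly_Mapping.lookup (F_comult t (basis w)) (Xpow a, v) =
    (if v = w \<and> a = x_degree w + t * int (y_degree w) then 1 else 0)"
proof (induction w arbitrary: a v)
  case (Xpow i)
  then show ?case
    by (auto simp: F_comult_Xpow lookup_single when_def)
next
  case (Xpow_y i w)
  then show ?case
    by (auto simp: lookup_comult_Xpow_y algebra_simps split: xy_word.splits)
qed

text \<open>
  Splitting off the first letter of \<open>w\<close> gives a term of \<open>\<Delta> w\<close> which occurs in \<open>\<Delta> z\<close> for no other \<open>z\<close>
  unless \<open>t * weight z < t * weight w\<close>.
\<close>

lemma lookup_comult_first_letter:
  assumes t: "t \<noteq> 0" and z: "t * weight (Xpow_y i w) \<le> t * weight z"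
    and u: "u = Xpow_y i (Xpow (x_degree w + t * int (y_degree w)))"
  shows "Poly_Mapping.lookup (F_comult t (basis z)) (u, Xpow i + w) =
    (if z = Xpow_y i w then 1 else 0)"
proof (cases z)
  case (Xpow j)
  then show ?thesis
    by (simp add: F_comult_Xpow lookup_single when_def u)
next
  case (Xpow_y j z')
  \<comment> \<open>These terms put the first letter of \<open>z\<close> on the right. The letter of
    \<open>u\<close> is then a later one, so some pair is in the wrong order; this is the 1 in
    \<open>int k + 1\<close> below.\<close>
  have "Poly_Mapping.lookup (F_comult t (basis z')) (Xpow (- j - t) + u, v') = 0"
    if v': "Xpow i + w = Xpow_y j v'" for v'
  proof (rule ccontr)
    assume *: "\<not> ?thesis"
    obtain k :: nat where k: "weight (Xpow (- j - t) + u) + weight v' = weight z' + t * int k"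
      using comult_weight [OF *] by blast
    have deg: "int (y_degree z') = 1 + int (y_degree v')"
      using comult_degree [OF *] by (simp add: y_degree_add u)
    have "weight (Xpow i + w) = j * (1 + int (y_degree v')) + weight v'"
      by (simp add: v')
    moreover have "y_degree (Xpow i + w) = Suc (y_degree v')"
      by (simp add: v')
    ultimately have "weight (Xpow_y i w) = weight z + t * (int k + 1)"
      using k deg by (simp add: u Xpow_y weight_Xpow_plus y_degree_add algebra_simps)
    \<comment> \<open>Multiplying by \<open>t\<close> makes the correction positive for either sign
      of \<open>t\<close>.\<close>
    then have "t * weight (Xpow_y i w) = t * weight z + (t * t) * (int k + 1)"
      by (simp add: algebra_simps)
    moreover have "(t * t) * (int k + 1) > 0"
      using t by (intro mult_pos_pos [where a = "t * t"]) (auto simp: zero_less_mult_iff)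
    ultimately show False
      using z by linarith
  qed
  \<comment> \<open>What remains has the first letter of \<open>z\<close> on the left; by
    \<open>lookup_comult_Xpow\<close> this requires \<open>j = i\<close> and
    \<open>z' = w\<close>.\<close>
  then show ?thesis
    by (auto simp: Xpow_y lookup_comult_Xpow_y u lookup_comult_Xpow Xpow_plus_Xpow_plus
        split: xy_word.splits)
qed

section \<open>The coradical filtration\<close>

lemma lookup_F_comult:
  "Poly_Mapping.lookup (F_comult t c) x = (\<Sum>w\<in>Poly_Mapping.keys c.
    Poly_Mapping.lookup c w * Poly_Mapping.lookup (F_comult t (basis w)) x)"
proof -
  interpret D: Vector_Spaces.linear smul smul "F_comult t"
    by (rule F_comult_linear)
  have "Poly_Mapping.lookup (F_comult t (\<Sum>w\<in>Poly_Mapping.keys c.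
      smul (Poly_Mapping.lookup c w) (basis w))) x = (\<Sum>w\<in>Poly_Mapping.keys c.
    Poly_Mapping.lookup c w * Poly_Mapping.lookup (F_comult t (basis w)) x)"
    unfolding D.sum D.scale lookup_sum lookup_smul ..
  then show ?thesis
    by (simp only: poly_mapping_expand [symmetric])
qed

lemma F_comult_grade:
  fixes c :: "'a::field F"
  assumes "c \<in> F_grade n"
  shows "F_comult t c \<in> supported_on {(u, v). y_degree u + y_degree v = n}"
  unfolding supported_on_iff
proof (intro allI impI)
  fix x assume x: "x \<notin> {(u, v). y_degree u + y_degree v = n}"
  obtain u v where uv: "x = (u, v)" by (cases x)
  show "Poly_Mapping.lookup (F_comult t c) x = 0"
  proof (subst lookup_F_comult, intro sum.neutral ballI)
    fix w assume "w \<in> Poly_Mapping.keys c"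
    then have "y_degree w = n"
      using assms by (auto simp: F_grade_eq supported_on_def)
    then have "Poly_Mapping.lookup (F_comult t (basis w)) x = (0 :: 'a)"
      using x uv comult_degree [of t w u v] by auto
    then show "Poly_Mapping.lookup c w * Poly_Mapping.lookup (F_comult t (basis w)) x = 0"
      by simp
  qed
qed

text \<open>The line through a grouplike element is a subcoalgebra, and a line has no proper nonzero
  subspace.\<close>

lemma simple_subcoalgebra_grouplike:
  fixes \<Delta> :: "('b \<Rightarrow>\<^sub>0 'k::field) \<Rightarrow> ('b \<times> 'b \<Rightarrow>\<^sub>0 'k)"
  assumes "Vector_Spaces.linear smul smul \<Delta>" "\<Delta> (basis g) = basis (g, g)"
  shows "simple_subcoalgebra \<Delta> (supported_on {g})"
proof -
  interpret D: Vector_Spaces.linear smul smul \<Delta> by fact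
  have sub: "subcoalgebra \<Delta> (supported_on {g})"
    unfolding subcoalgebra_def tensor_space_supported_on
  proof (intro conjI ballI subspace_supported_on)
    fix d :: "'b \<Rightarrow>\<^sub>0 'k" assume "d \<in> supported_on {g}"
    moreover have "(supported_on {g} :: ('b \<Rightarrow>\<^sub>0 'k) set) \<subseteq> \<Delta> -` supported_on ({g} \<times> {g})"
      by (rule supported_on_subsetI [OF D.subspace_vimage [OF subspace_supported_on]])
        (use assms(2) in simp)
    ultimately show "\<Delta> d \<in> supported_on ({g} \<times> {g})"
      by blast
  qed
  show ?thesis
    unfolding simple_subcoalgebra_def
  proof (intro conjI allI impI sub)
    have "(basis g :: 'b \<Rightarrow>\<^sub>0 'k) \<in> supported_on {g}"
      by simp
    moreover have "(basis g :: 'b \<Rightarrow>\<^sub>0 'k) \<noteq> 0"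
      by (simp flip: keys_eq_empty)
    ultimately show "supported_on {g} \<noteq> {0 :: 'b \<Rightarrow>\<^sub>0 'k}"
      by blast
    fix E assume E: "subcoalgebra \<Delta> E \<and> E \<subseteq> supported_on {g}"
    then have sE: "pm_subspace E"
      by (simp add: subcoalgebra_def)
    show "E = {0} \<or> E = supported_on {g}"
    proof (cases "E \<subseteq> {0}")
      case True
      then show ?thesis
        using pm.subspace_0 [OF sE] by blast
    next
      case False
      then obtain e where e: "e \<in> E" "e \<noteq> 0" by blast
      then have "e \<in> supported_on {g}"
        using E by auto
      define c where "c = Poly_Mapping.lookup e g"
      have e_eq: "e = Poly_Mapping.single g c"
        using \<open>e \<in> supported_on {g}\<close>
        by (intro poly_mapping_eqI) (auto simp: supported_on_iff lookup_single when_def c_def)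
      then have "c \<noteq> 0"
        using e(2) by auto
      then have "basis g = smul (inverse c) e"
        unfolding e_eq by simp
      then have "basis g \<in> E"
        using pm.subspace_scale [OF sE e(1)] by simp
      then show ?thesis
        using E supported_on_subsetI [OF sE, of "{g}"] by blast
    qed
  qed
qed

lemma simple_subcoalgebra_F:
  fixes D :: "'a::field F set"
  assumes D: "simple_subcoalgebra (F_comult t) D"
  obtains i where "D = supported_on {Xpow i}"
proof -
  have sD: "pm_subspace D" and cD: "\<And>d. d \<in> D \<Longrightarrow> F_comult t d \<in> tensor_space D D" and "D \<noteq> {0}"
    using D by (simp_all add: simple_subcoalgebra_def subcoalgebra_def)
  then obtain d where d: "d \<in> D" "d \<noteq> 0"
    using pm.subspace_0 [OF sD] by blast
  define n where "n = Max (y_degree ` Poly_Mapping.keys d)"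
  have ne: "Poly_Mapping.keys d \<noteq> {}"
    using d by simp
  then have "n \<in> y_degree ` Poly_Mapping.keys d"
    unfolding n_def by (intro Max_in) auto
  then obtain w where w: "w \<in> Poly_Mapping.keys d" "y_degree w = n" by blast
  have max: "y_degree z \<le> y_degree w" if "z \<in> Poly_Mapping.keys d" for z
    unfolding w(2) n_def using that by (intro Max_ge) auto
  define i where "i = x_degree w + t * int (y_degree w)"
  obtain e where e: "e \<in> D"
    "\<And>u. Poly_Mapping.lookup e u = Poly_Mapping.lookup (F_comult t d) (u, w)"
    using tensor_space_slice [OF sD cD [OF d(1)]] by metis
  \<comment> \<open>As \<open>w\<close> has maximal degree, a right factor \<open>w\<close> leaves
    degree 0 for the left factor; \<open>lookup_comult_Xpow\<close> then forces \<open>z = w\<close>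
    and the exponent \<open>i\<close>.\<close>
  have "Poly_Mapping.lookup (F_comult t (basis z)) (u, w)
      = (if z = w then (1 :: 'a) when u = Xpow i else 0)"
    if "z \<in> Poly_Mapping.keys d" for z u
  proof (cases u)
    case (Xpow a)
    then show ?thesis
      by (auto simp: lookup_comult_Xpow i_def when_def)
  next
    case (Xpow_y j u')
    then have "y_degree u + y_degree w \<noteq> y_degree z"
      using max [OF that] by simp
    then show ?thesis
      using comult_degree [of t z u w] Xpow_y by (auto simp: when_def)
  qed
  then have "Poly_Mapping.lookup e u = (\<Sum>z\<in>Poly_Mapping.keys d.
      if z = w then (Poly_Mapping.lookup d w when u = Xpow i) else 0)" for u
    unfolding e(2) by (subst lookup_F_comult, intro sum.cong) (auto simp: when_def)
  then have "e = Poly_Mapping.single (Xpow i) (Poly_Mapping.lookup d w)"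
    using w(1) by (intro poly_mapping_eqI) (auto simp: lookup_single when_def)
  then have "basis (Xpow i) = smul (inverse (Poly_Mapping.lookup d w)) e"
    using w(1) by (simp add: in_keys_iff)
  then have "basis (Xpow i) \<in> D"
    using pm.subspace_scale [OF sD e(1)] by simp
  then have "supported_on {Xpow i} \<subseteq> D"
    by (intro supported_on_subsetI sD) simp
  moreover have "simple_subcoalgebra (F_comult t) (supported_on {Xpow i} :: 'a F set)"
    by (rule simple_subcoalgebra_grouplike [OF F_comult_linear F_comult_Xpow])
  \<comment> \<open>Simplicity of the line supplies that it is a nonzero subcoalgebra; simplicity of
    \<open>D\<close> then gives equality.\<close>
  ultimately have "D = supported_on {Xpow i}"
    using D unfolding simple_subcoalgebra_def by metis
  then show thesis by (rule that)
qed

lemma coradical_F: "coradical (F_comult t) = (F_grade 0 :: 'a::field F set)"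
proof
  show "(F_grade 0 :: 'a F set) \<subseteq> coradical (F_comult t)"
    unfolding F_grade_eq coradical_def
  proof (intro supported_on_subsetI pm.subspace_span pm.span_base)
    fix w assume "w \<in> {w. y_degree w = 0}"
    then obtain i where w: "w = Xpow i"
      by (cases w) auto
    have "simple_subcoalgebra (F_comult t) (supported_on {w} :: 'a F set)"
      unfolding w by (rule simple_subcoalgebra_grouplike [OF F_comult_linear F_comult_Xpow])
    then show "(basis w :: 'a F) \<in> \<Union> {D. simple_subcoalgebra (F_comult t) D}"
      by (intro UnionI [of "supported_on {w}"]) simp_all
  qed
  show "coradical (F_comult t) \<subseteq> (F_grade 0 :: 'a F set)"
    unfolding coradical_def F_grade_eq
  proof (rule pm.span_minimal [OF _ subspace_supported_on], rule Union_least)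
    fix D :: "'a F set" assume "D \<in> {D. simple_subcoalgebra (F_comult t) D}"
    then obtain i where "D = supported_on {Xpow i}"
      using simple_subcoalgebra_F by blast
    moreover have "{Xpow i} \<subseteq> {w. y_degree w = 0}"
      by simp
    ultimately show "D \<subseteq> supported_on {w. y_degree w = 0}"
      by (simp only: supported_on_def) blast
  qed
qed

text \<open>With the coradical known, the left side consists of those \<open>c\<close> for which no
  term of \<Delta> c has a letter y in both factors.\<close>

lemma coradical_filtration_1_F:
  assumes "t \<noteq> 0"
  shows "coradical_filtration (F_comult t) 1 = subspace_sum (F_grade 0) (F_grade 1 :: 'a::field F set)"
proof -
  have filt: "coradical_filtration (F_comult t :: 'a F \<Rightarrow> _) 1
      = F_comult t -` supported_on {(u, v). y_degree u = 0 \<or> y_degree v = 0}"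
  proof -
    have "UNIV \<times> {w. y_degree w = 0} \<union> {w. y_degree w = 0} \<times> UNIV
        = {(u, v). y_degree u = 0 \<or> y_degree v = 0}"
      by auto
    then show ?thesis
      by (simp add: coradical_F F_grade_eq tensor_space_supported_on subspace_sum_supported_on
          flip: supported_on_UNIV)
  qed
  have sum: "subspace_sum (F_grade 0) (F_grade 1 :: 'a F set) = supported_on {w. y_degree w \<le> 1}"
  proof -
    have "{w. y_degree w = 0} \<union> {w. y_degree w = 1} = {w. y_degree w \<le> 1}"
      by auto
    then show ?thesis
      by (simp add: F_grade_eq subspace_sum_supported_on)
  qed
  show ?thesis
    unfolding filt sum
  proof
    show "(supported_on {w. y_degree w \<le> 1} :: 'a F set)
        \<subseteq> F_comult t -` supported_on {(u, v). y_degree u = 0 \<or> y_degree v = 0}"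
    proof (rule supported_on_subsetI)
      interpret D: Vector_Spaces.linear smul smul "F_comult t :: 'a F \<Rightarrow> _"
        by (rule F_comult_linear)
      show "pm_subspace ((F_comult t :: 'a F \<Rightarrow> _) -` supported_on {(u, v). y_degree u = 0 \<or> y_degree v = 0})"
        by (rule D.subspace_vimage [OF subspace_supported_on])
      show "(basis w :: 'a F) \<in> F_comult t -` supported_on {(u, v). y_degree u = 0 \<or> y_degree v = 0}"
        if "w \<in> {w. y_degree w \<le> 1}" for w
        unfolding vimage_eq supported_on_iff
      proof (intro allI impI)
        fix x assume x: "x \<notin> {(u, v). y_degree u = 0 \<or> y_degree v = 0}"
        obtain u v where "x = (u, v)" by (cases x)
        then show "Poly_Mapping.lookup (F_comult t (basis w)) x = (0 :: 'a)"
          using x that comult_degree [of t w u v] by auto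
      qed
    qed
    show "(F_comult t :: 'a F \<Rightarrow> _) -` supported_on {(u, v). y_degree u = 0 \<or> y_degree v = 0}
        \<subseteq> supported_on {w. y_degree w \<le> 1}"
    proof
      fix c :: "'a F" assume c: "c \<in> F_comult t -` supported_on {(u, v). y_degree u = 0 \<or> y_degree v = 0}"
      let ?A = "{w \<in> Poly_Mapping.keys c. 1 < y_degree w}"
      have "?A = {}"
      proof (rule ccontr)
        assume "?A \<noteq> {}"
        \<comment> \<open>The minimum runs over all words of degree at least 2 together, so
          \<open>c\<close> need not be homogeneous.\<close>
        then obtain w where w: "w \<in> ?A"
          and min: "\<And>z. z \<in> ?A \<Longrightarrow> t * weight w \<le> t * weight z"
          using ex_min_if_finite [of "(\<lambda>w. t * weight w) ` ?A"]
          by (force simp: not_less)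
        \<comment> \<open>Degree at least 2 leaves a letter in \<open>w'\<close>, so both
          \<open>u\<close> and \<open>Xpow i + w'\<close> will contain a y.\<close>
        then obtain i w' where w': "w = Xpow_y i w'" "y_degree w' \<noteq> 0"
          by (cases w) auto
        define u where "u = Xpow_y i (Xpow (x_degree w' + t * int (y_degree w')))"
        have "Poly_Mapping.lookup (F_comult t (basis z)) (u, Xpow i + w')
            = (if z = w then 1 else 0 :: 'a)"
          if "z \<in> Poly_Mapping.keys c" for z
        proof (cases "1 < y_degree z")
          case True
          then show ?thesis
            using lookup_comult_first_letter [OF assms _ u_def, of z] min that w'(1) by simp
        next
          \<comment> \<open>Minimality says nothing about words of degree at most 1, but the two
            factors have total degree at least 2.\<close>
          case False
          then have "y_degree u + y_degree (Xpow i + w') \<noteq> y_degree z" "z \<noteq> w"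
            using w'(2) w by (auto simp: u_def y_degree_add)
          then show ?thesis
            using comult_degree by metis
        qed
        then have "Poly_Mapping.lookup (F_comult t c) (u, Xpow i + w')
            = (\<Sum>z\<in>Poly_Mapping.keys c. if z = w then Poly_Mapping.lookup c w else 0)"
          by (subst lookup_F_comult, intro sum.cong) auto
        also have "\<dots> \<noteq> 0"
          using w by (simp add: in_keys_iff)
        finally show False
          using c w'(2) by (auto simp: supported_on_iff u_def y_degree_add)
      qed
      then show "c \<in> supported_on {w. y_degree w \<le> 1}"
        by (auto simp: supported_on_def not_less)
    qed
  qed
qed

section \<open>The coradically graded Hopf algebra\<close>

theorem proposition4p2:
  fixes t :: int
  assumes "t \<noteq> 0"
  shows "coradically_graded_hopf_algebra
           (F_comult t :: 'k::{alg_closed_field, field_char_0} F \<Rightarrow> _)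
           F_counit (F_antipode t) F_grade \<and>
         coradical_filtration (F_comult t :: 'k F \<Rightarrow> _) 0 = F_grade 0 \<and>
         coradical_filtration (F_comult t :: 'k F \<Rightarrow> _) 1 = subspace_sum (F_grade 0) (F_grade 1)"
proof -
  have coradical: "coradical_filtration (F_comult t :: 'k F \<Rightarrow> _) 0 = F_grade 0"
    by (simp add: coradical_F)
  have comult_graded: "F_comult t c \<in> pm_span (\<Union>i\<in>{0..n}. tensor_space (F_grade i) (F_grade (n - i)))"
    if "c \<in> F_grade n" for c :: "'k F" and n
  proof -
    \<comment> \<open>A basis pair (u, v) lies in the summand with index i =
      \<open>y_degree u\<close>.\<close>
    have "supported_on {(u, v). y_degree u + y_degree v = n}
        \<subseteq> pm_span (\<Union>i\<in>{0..n}. tensor_space (F_grade i) (F_grade (n - i) :: 'k F set))"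
      by (intro supported_on_subsetI pm.subspace_span pm.span_base)
        (auto simp: F_grade_eq tensor_space_supported_on)
    then show ?thesis
      using F_comult_grade [OF that] by blast
  qed
  have counit_graded: "F_counit c = 0" if "n \<ge> 1" "c \<in> F_grade n" for c :: "'k F" and n
  proof -
    \<comment> \<open>The counit sends y to 0, so it kills every word containing a y.\<close>
    have "word_eval 1 1 0 w = (0 :: 'k)" if "y_degree w = n" for w
      using that \<open>n \<ge> 1\<close> by (cases w) auto
    then show ?thesis
      using that(2) unfolding F_counit_def F_eval_def lin_ext_def F_grade_eq supported_on_def
      by (intro sum.neutral) auto
  qed
  have "coradically_graded_hopf_algebra (F_comult t :: 'k F \<Rightarrow> _) F_counit (F_antipode t) F_grade"
    by (intro coradically_graded_hopf_algebra.intro graded_hopf_algebra.intro hopf_algebra.intro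
        coradically_graded_coalgebra.intro graded_coalgebra.intro coalgebra.intro
        graded_hopf_algebra_axioms.intro hopf_algebra_axioms.intro
        coradically_graded_coalgebra_axioms.intro graded_coalgebra_axioms.intro)
      ((rule F_comult_linear F_counit_linear F_coassoc F_counit_left F_counit_right F_comult_hom
          F_counit_hom F_antipode_linear F_antipode_left F_antipode_right direct_sum_F_grade
          F_x_grade [of 0, unfolded F_x_0] coradical coradical_filtration_1_F [OF assms])
        | (erule (1) counit_graded F_grade_mult) | (erule comult_graded F_antipode_grade))+
  then show ?thesis
    using coradical coradical_filtration_1_F [OF assms] by blast
qed

end
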